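(* Let $n=p+q>1$. For almost every $(\lambda,\gamma,\tau)\in\mathbb R^3$ and every $k=0,1,2,\ldots$ there exist nonzero $\mathfrak o(p+1,q+1)$-invariant differential operators $$B_{2k}:\mathcal F_\lambda\otimes\mathcal F_\gamma\otimes\mathcal F_\tau\to\mathcal F_{\lambda+\gamma+\tau+\frac{2k}{n}},\qquad B_{2k}=\sum_{a+b+c+d+e+f=k}\alpha_{a,b,c,d,e,f}\,\mathrm R^{a,b,c,d,e,f},$$ where the constants $\alpha_{a,b,c,d,e,f}$ are given by the following induction formulas (for all integers $a,b,c,d,e,f\ge0$ with $a+b+c+d+e+f=k-1$, coefficients with a negative index being $0$): $$\begin{aligned} &2(a+1)(2(a+1)+n(2\lambda-1))\,\alpha_{a+1,b,c,d,e,f}-(b+2)(b+1)\,\alpha_{a,b+2,c,d-1,e,f}\\ &\ -2(b+1)(c+1)\,\alpha_{a,b+1,c+1,d,e-1,f}+2(b+1)(b+e+2d+n\gamma)\,\alpha_{a,b+1,c,d,e,f}\\ &\ -(c+2)(c+1)\,\alpha_{a,b,c+2,d,e,f-1}+2(c+1)(c+e+2f+n\tau)\,\alpha_{a,b,c+1,d,e,f}=0,\\[1mm] &2(d+1)(2(d+1)+n(2\gamma-1))\,\alpha_{a,b,c,d+1,e,f}-(b+2)(b+1)\,\alpha_{a-1,b+2,c,d,e,f}\\ &\ -2(b+1)(e+1)\,\alpha_{a,b+1,c-1,d,e+1,f}+2(b+1)(b+c+2a+n\lambda)\,\alpha_{a,b+1,c,d,e,f}\\ &\ -(e+2)(e+1)\,\alpha_{a,b,c,d,e+2,f-1}+2(e+1)(c+e+2f+n\tau)\,\alpha_{a,b,c,d,e+1,f}=0,\\[1mm]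 &2(f+1)(2(f+1)+n(2\tau-1))\,\alpha_{a,b,c,d,e,f+1}-(e+2)(e+1)\,\alpha_{a,b,c,d-1,e+2,f}\\ &\ -2(e+1)(c+1)\,\alpha_{a,b-1,c+1,d,e+1,f}+2(e+1)(b+e+2d+n\gamma)\,\alpha_{a,b,c,d,e+1,f}\\ &\ -(c+2)(c+1)\,\alpha_{a-1,b,c+2,d,e,f}+2(c+1)(c+b+2a+n\lambda)\,\alpha_{a,b,c+1,d,e,f}=0. \end{aligned}$$
   Context: $\mathbb R^n$ carries the standard flat pseudo-Riemannian metric $g$ of signature $(p,q)$, $p+q=n$; indices are raised and lowered with $g$, repeated indices are summed, and $x_i=g_{is}x^s$. The Lie algebra $\mathfrak o(p+1,q+1)$ is realized as the Lie algebra of vector fields on $\mathbb R^n$ generated by $X_i=\frac{\partial}{\partial x^i}$, $X_{ij}=x_i\frac{\partial}{\partial x^j}-x_j\frac{\partial}{\partial x^i}$, $X_0=x^i\frac{\partial}{\partial x^i}$, $\overline{X_i}=x_jx^j\frac{\partial}{\partial x^i}-2x_ix^j\frac{\partial}{\partial x^j}$. $\mathcal F_\lambda$ ($\lambda\in\mathbb R$) is the space of $\lambda$-densities $\varphi|\mathrm{vol}|^\lambda$ on $\mathbb R^n$, on which a vector field $X=X^i\partial_i$ acts by $L_X(\varphi|\mathrm{vol}|^\lambda)=(X^i\partial_i\varphi+\lambda\,\mathrm{Div}(X)\varphi)|\mathrm{vol}|^\lambda$, $\mathrm{Div}(X)=\partial_iX^i$. A ternary differential operator $B:\mathcal F_\lambda\otimes\mathcal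 F_\gamma\otimes\mathcal F_\tau\to\mathcal F_\mu$ is invariant with respect to a Lie algebra of vector fields if $L_XB(a,b,c)=B(L_Xa,b,c)+B(a,L_Xb,c)+B(a,b,L_Xc)$ for all $X$ in it. Operators are identified with their symbols: polynomials in $\xi_i,\eta_i,\zeta_i$ stand for the constant-coefficient ternary operators in which $\xi_i,\eta_i,\zeta_i$ denote $\partial/\partial x^i$ applied to the first, second and third argument respectively, after which the three resulting functions are multiplied. Put $\mathrm R_{\xi\xi}=\xi^i\xi_i$, $\mathrm R_{\xi\eta}=\xi^i\eta_i$, $\mathrm R_{\xi\zeta}=\xi^i\zeta_i$, $\mathrm R_{\eta\eta}=\eta^i\eta_i$, $\mathrm R_{\eta\zeta}=\eta^i\zeta_i$, $\mathrm R_{\zeta\zeta}=\zeta^i\zeta_i$, and $\mathrm R^{a,b,c,d,e,f}=\mathrm R_{\xi\xi}^a\mathrm R_{\xi\eta}^b\mathrm R_{\xi\zeta}^c\mathrm R_{\eta\eta}^d\mathrm R_{\eta\zeta}^e\mathrm R_{\zeta\zeta}^f$. "Almost every" is understood with respect to Lebesgue measure on $\mathbb R^3$. *)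

theory Defs
  imports "HOL-Analysis.Analysis" "HOL-Library.Poly_Mapping"
begin

definition pd :: "'n \<Rightarrow> (real^'n::finite \<Rightarrow> real) \<Rightarrow> real^'n \<Rightarrow> real" where
  "pd i f x = frechet_derivative f (at x) (axis i 1)"

(* C-infinity on the whole space: every iterated partial derivative is differentiable everywhere. *)
definition smooth :: "(real^'n::finite \<Rightarrow> real) \<Rightarrow> bool" where
  "smooth f \<longleftrightarrow> (\<forall>is x. foldr pd is f differentiable at x)"

(* The flat metric: Pos is the set of coordinate directions of positive square, so that the
   signature is (card Pos, card (- Pos)). *)
definition flat_metric :: "'n set \<Rightarrow> real^'n^'n::finite" where
  "flat_metric Pos = (\<chi> i j. if i = j then (if i \<in> Pos then 1 else -1) else 0)"

definition lower :: "'n set \<Rightarrow> real^'n::finite \<Rightarrow> real^'n" where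
  "lower Pos x = flat_metric Pos *v x"


subsection \<open>Vector fields\<close>

type_synonym 'n vfield = "real^'n \<Rightarrow> real^'n"

definition divergence :: "'n::finite vfield \<Rightarrow> real^'n \<Rightarrow> real" where
  "divergence X x = (\<Sum>i\<in>UNIV. pd i (\<lambda>y. X y $ i) x)"

definition bracket :: "'n::finite vfield \<Rightarrow> 'n vfield \<Rightarrow> 'n vfield" where
  "bracket X Y x =
     (\<chi> j. \<Sum>i\<in>UNIV. X x $ i * pd i (\<lambda>y. Y y $ j) x - Y x $ i * pd i (\<lambda>y. X y $ j) x)"

definition vf_translation :: "'n \<Rightarrow> 'n::finite vfield" where
  "vf_translation i x = axis i 1"

definition vf_rotation :: "'n set \<Rightarrow> 'n \<Rightarrow> 'n \<Rightarrow> 'n::finite vfield" where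
  "vf_rotation Pos i j x = (lower Pos x $ i) *\<^sub>R axis j 1 - (lower Pos x $ j) *\<^sub>R axis i 1"

definition vf_euler :: "'n::finite vfield" where
  "vf_euler x = (\<Sum>i\<in>UNIV. x $ i *\<^sub>R axis i 1)"

definition vf_inversion :: "'n set \<Rightarrow> 'n \<Rightarrow> 'n::finite vfield" where
  "vf_inversion Pos i x =
     (\<Sum>j\<in>UNIV. lower Pos x $ j * x $ j) *\<^sub>R axis i 1
     - (\<Sum>j\<in>UNIV. (2 * lower Pos x $ i * x $ j) *\<^sub>R axis j 1)"

(* The Lie algebra o(p+1,q+1) as the Lie algebra of vector fields generated by the fields above. *)
inductive_set conf_algebra :: "'n set \<Rightarrow> 'n::finite vfield set" for Pos :: "'n set" where
  translation: "vf_translation i \<in> conf_algebra Pos"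
| rotation: "vf_rotation Pos i j \<in> conf_algebra Pos"
| euler: "vf_euler \<in> conf_algebra Pos"
| inversion: "vf_inversion Pos i \<in> conf_algebra Pos"
| add: "X \<in> conf_algebra Pos \<Longrightarrow> Y \<in> conf_algebra Pos \<Longrightarrow> (\<lambda>x. X x + Y x) \<in> conf_algebra Pos"
| scale: "X \<in> conf_algebra Pos \<Longrightarrow> (\<lambda>x. c *\<^sub>R X x) \<in> conf_algebra Pos"
| brack: "X \<in> conf_algebra Pos \<Longrightarrow> Y \<in> conf_algebra Pos \<Longrightarrow> bracket X Y \<in> conf_algebra Pos"


subsection \<open>Densities and invariant ternary operators\<close>

(* A density phi |vol|^w is represented by its coefficient function phi, so the space of
   w-densities is the set of smooth functions; the weight w only enters through the action. *)
definition lie_deriv :: "real \<Rightarrow> 'n::finite vfield \<Rightarrow> (real^'n \<Rightarrow> real) \<Rightarrow> real^'n \<Rightarrow> real" where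
  "lie_deriv w X \<phi> x = (\<Sum>i\<in>UNIV. X x $ i * pd i \<phi> x) + w * divergence X x * \<phi> x"

type_synonym 'n ternary_op =
  "(real^'n \<Rightarrow> real) \<Rightarrow> (real^'n \<Rightarrow> real) \<Rightarrow> (real^'n \<Rightarrow> real) \<Rightarrow> real^'n \<Rightarrow> real"

(* Invariance of B as an operator from densities of weights l, g, t to densities of weight m. *)
definition invariant_op ::
  "'n::finite vfield set \<Rightarrow> real \<Rightarrow> real \<Rightarrow> real \<Rightarrow> real \<Rightarrow> 'n ternary_op \<Rightarrow> bool" where
  "invariant_op A l g t m B \<longleftrightarrow>
     (\<forall>X\<in>A. \<forall>u v w. smooth u \<longrightarrow> smooth v \<longrightarrow> smooth w \<longrightarrow>
        (\<forall>x. lie_deriv m X (B u v w) x =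
             B (lie_deriv l X u) v w x + B u (lie_deriv g X v) w x + B u v (lie_deriv t X w) x))"

definition nonzero_op :: "'n::finite ternary_op \<Rightarrow> bool" where
  "nonzero_op B \<longleftrightarrow> (\<exists>u v w x. smooth u \<and> smooth v \<and> smooth w \<and> B u v w x \<noteq> 0)"


subsection \<open>Symbols\<close>

datatype slot = Xi | Eta | Zeta

(* Real polynomials in the variables xi_i, eta_i, zeta_i, with the ring structure of
   finitely supported functions under convolution. *)
type_synonym 'n symbol = "((slot \<times> 'n) \<Rightarrow>\<^sub>0 nat) \<Rightarrow>\<^sub>0 real"

definition var :: "slot \<Rightarrow> 'n \<Rightarrow> 'n symbol" where
  "var s i = Poly_Mapping.single (Poly_Mapping.single (s, i) 1) 1"

definition const :: "real \<Rightarrow> 'n symbol" where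
  "const c = Poly_Mapping.single 0 c"

(* The partial derivative with multi-index k.  The partial derivatives of a smooth function
   commute, so the order of differentiation, left to the choice operator, is immaterial. *)
definition multi_pd ::
    "('n \<Rightarrow> nat) \<Rightarrow> (real^'n::finite \<Rightarrow> real) \<Rightarrow> real^'n \<Rightarrow> real" where
  "multi_pd k f = foldr pd (SOME is. \<forall>i. count_list is i = k i) f"

definition symbol_op :: "'n symbol \<Rightarrow> 'n::finite ternary_op" where
  "symbol_op S u v w x =
     (\<Sum>m\<in>Poly_Mapping.keys S. Poly_Mapping.lookup S m
        * multi_pd (\<lambda>i. Poly_Mapping.lookup m (Xi, i)) u x
        * multi_pd (\<lambda>i. Poly_Mapping.lookup m (Eta, i)) v x
        * multi_pd (\<lambda>i. Poly_Mapping.lookup m (Zeta, i)) w x)"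

(* Contraction of two covectors, hence with the inverse metric. *)
definition R2 :: "'n set \<Rightarrow> slot \<Rightarrow> slot \<Rightarrow> 'n::finite symbol" where
  "R2 Pos s t =
     (\<Sum>i\<in>UNIV. \<Sum>j\<in>UNIV. const (matrix_inv (flat_metric Pos) $ i $ j) * var s i * var t j)"

definition Rmon :: "'n set \<Rightarrow> nat \<Rightarrow> nat \<Rightarrow> nat \<Rightarrow> nat \<Rightarrow> nat \<Rightarrow> nat \<Rightarrow> 'n::finite symbol" where
  "Rmon Pos a b c d e f =
     R2 Pos Xi Xi ^ a * R2 Pos Xi Eta ^ b * R2 Pos Xi Zeta ^ c
     * R2 Pos Eta Eta ^ d * R2 Pos Eta Zeta ^ e * R2 Pos Zeta Zeta ^ f"

type_synonym coeffs = "nat \<Rightarrow> nat \<Rightarrow> nat \<Rightarrow> nat \<Rightarrow> nat \<Rightarrow> nat \<Rightarrow> real"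

definition B_symbol :: "'n set \<Rightarrow> nat \<Rightarrow> coeffs \<Rightarrow> 'n::finite symbol" where
  "B_symbol Pos k \<alpha> =
     (\<Sum>(a,b,c,d,e,f) \<in> {(a,b,c,d,e,f). a + b + c + d + e + f = k}.
        const (\<alpha> a b c d e f) * Rmon Pos a b c d e f)"

abbreviation B_op :: "'n set \<Rightarrow> nat \<Rightarrow> coeffs \<Rightarrow> 'n::finite ternary_op" where
  "B_op Pos k \<alpha> \<equiv> symbol_op (B_symbol Pos k \<alpha>)"


subsection \<open>The induction formulas\<close>

(* Coefficients carry integer indices here; they vanish as soon as one index is negative. *)
definition zcoef :: "coeffs \<Rightarrow> int \<Rightarrow> int \<Rightarrow> int \<Rightarrow> int \<Rightarrow> int \<Rightarrow> int \<Rightarrow> real" where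
  "zcoef \<alpha> a b c d e f =
     (if a \<ge> 0 \<and> b \<ge> 0 \<and> c \<ge> 0 \<and> d \<ge> 0 \<and> e \<ge> 0 \<and> f \<ge> 0
      then \<alpha> (nat a) (nat b) (nat c) (nat d) (nat e) (nat f) else 0)"

definition induction_formulas :: "nat \<Rightarrow> real \<Rightarrow> real \<Rightarrow> real \<Rightarrow> nat \<Rightarrow> coeffs \<Rightarrow> bool" where
  "induction_formulas n (l::real) (g::real) (t::real) k \<alpha> \<longleftrightarrow>
    (let A = zcoef \<alpha> in
     \<forall>a b c d e f :: int.
       a \<ge> 0 \<and> b \<ge> 0 \<and> c \<ge> 0 \<and> d \<ge> 0 \<and> e \<ge> 0 \<and> f \<ge> 0 \<and> a + b + c + d + e + f = int k - 1 \<longrightarrow>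
       2*(a+1) * (2*(a+1) + real n*(2*l - 1)) * A (a+1) b c d e f
         - (b+2)*(b+1) * A a (b+2) c (d-1) e f
         - 2*(b+1)*(c+1) * A a (b+1) (c+1) d (e-1) f
         + 2*(b+1) * (b + e + 2*d + real n*g) * A a (b+1) c d e f
         - (c+2)*(c+1) * A a b (c+2) d e (f-1)
         + 2*(c+1) * (c + e + 2*f + real n*t) * A a b (c+1) d e f = 0 \<and>
       2*(d+1) * (2*(d+1) + real n*(2*g - 1)) * A a b c (d+1) e f
         - (b+2)*(b+1) * A (a-1) (b+2) c d e f
         - 2*(b+1)*(e+1) * A a (b+1) (c-1) d (e+1) f
         + 2*(b+1) * (b + c + 2*a + real n*l) * A a (b+1) c d e f
         - (e+2)*(e+1) * A a b c d (e+2) (f-1)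
         + 2*(e+1) * (c + e + 2*f + real n*t) * A a b c d (e+1) f = 0 \<and>
       2*(f+1) * (2*(f+1) + real n*(2*t - 1)) * A a b c d e (f+1)
         - (e+2)*(e+1) * A a b c (d-1) (e+2) f
         - 2*(e+1)*(c+1) * A a (b-1) (c+1) d (e+1) f
         + 2*(e+1) * (b + e + 2*d + real n*g) * A a b c d (e+1) f
         - (c+2)*(c+1) * A (a-1) b (c+2) d e f
         + 2*(c+1) * (c + b + 2*a + real n*l) * A a b (c+1) d e f = 0)"

end

theory Submission
  imports Defs
begin

text \<open>
A constant-coefficient ternary operator is a polynomial \<open>S\<close> in the covectors \<open>\<xi>\<close>, \<open>\<eta>\<close>,
\<open>\<zeta>\<close>. Its commutator with multiplication of an argument by a coordinate is the operator of a
derivative of \<open>S\<close> (\<open>sf_op_slot_coord\<close>). Since the conformal fields have coefficients of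
degree at most two, the defect of equivariance of \<open>S\<close> under such a field is a polynomial of
degree at most two in the coordinates whose coefficients are operators of symbols. For
translations it vanishes by the Leibniz rule, for rotations because \<open>S\<close> is built from metric
contractions, and for the Euler field because \<open>S\<close> is homogeneous of degree \<open>2k\<close> and the target
weight is shifted by \<open>2k/n\<close>. For an inversion the terms of degree two and one cancel for the same
three reasons, and what remains is a second order operator in \<open>S\<close> (\<open>equivariant_inversion\<close>).
Applied to a monomial in the six contractions it gives a combination of \<open>\<xi>\<^sub>i\<close>, \<open>\<eta>\<^sub>i\<close>, \<open>\<zeta>\<^sub>i\<close>
(\<open>inv_zmon\<close>), and its vanishing follows from the three induction formulas, one for each covector
(\<open>inv_B_symbol\<close>). Equivariance passes to brackets because the Lie derivative of densities is a
representation, so every solution of the formulas gives an invariant operator.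

For the existence of solutions it is enough to let the operator differentiate only two of the three
arguments, that is, to look for coefficients supported on \<open>c = e = f = 0\<close>. There remain two
recursions for a function of \<open>(a, b, d)\<close>, in general still more equations than unknowns. Generically the first
recursion extends an arbitrary row \<open>a = 0\<close> uniquely, and the row can be chosen such that the
second recursion holds on it. The two recursions commute up to a shift
(\<open>defect1_defect2_commute\<close>), a trace of the commutativity of the inversions; hence the defect in
the second recursion satisfies a homogeneous recursion starting from zero, and vanishes
(\<open>bin_coeff_defect2\<close>). The resulting operator is nonzero because on exponentials it takes the
value of its symbol, and in dimension at least two the contractions of two covectors are
algebraically independent (\<open>nonzero_binary\<close>). The genericity conditions exclude countably many
hyperplanes in the space of weights (\<open>AE_generic_weights\<close>).
\<close>

section \<open>Partial derivatives of smooth functions\<close>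

lemma pd_eq: "(f has_derivative f') (at x) \<Longrightarrow> pd i f x = f' (axis i 1)"
  unfolding pd_def by (metis frechet_derivative_at)

lemma pd_add: "f differentiable at x \<Longrightarrow> g differentiable at x \<Longrightarrow>
    pd i (\<lambda>y. f y + g y) x = pd i f x + pd i g x"
  unfolding frechet_derivative_works
  by (subst pd_eq, rule has_derivative_add, assumption, assumption) (simp add: pd_def)

lemma pd_mult: "f differentiable at x \<Longrightarrow> g differentiable at x \<Longrightarrow>
    pd i (\<lambda>y. f y * g y) x = f x * pd i g x + pd i f x * g x"
  unfolding frechet_derivative_works
  by (subst pd_eq, rule has_derivative_mult, assumption, assumption) (simp add: pd_def)

lemma pd_const [simp]: "pd i (\<lambda>y. c) = (\<lambda>x. 0)"
  by (rule ext, subst pd_eq, rule has_derivative_const) simp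

lemma pd_coord: "pd i (\<lambda>y. y $ j) = (\<lambda>x. if i = j then 1 else 0)" for i j :: "'n::finite"
proof
  fix x :: "real^'n"
  have "((\<lambda>y. y $ j) has_derivative (\<lambda>y. y $ j)) (at x)"
    by (rule bounded_linear_imp_has_derivative[OF bounded_linear_vec_nth])
  then show "pd i (\<lambda>y. y $ j) x = (if i = j then 1 else 0)"
    by (simp add: pd_eq axis_def)
qed

lemma exp_inner_has_derivative:
  "((\<lambda>y. exp (c \<bullet> y)) has_derivative (\<lambda>h. (c \<bullet> h) * exp (c \<bullet> x))) (at x)"
  for c x :: "real^'n::finite"
  by (auto intro!: derivative_eq_intros)

lemma pd_exp: "pd i (\<lambda>y. exp (c \<bullet> y)) = (\<lambda>x. c $ i * exp (c \<bullet> x))" for c :: "real^'n::finite"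
  by (rule ext, subst pd_eq, rule exp_inner_has_derivative) (simp add: inner_axis)

lemma smooth_differentiable: "smooth f \<Longrightarrow> f differentiable at x"
  unfolding smooth_def by (metis foldr.simps(1) id_apply)

lemma smooth_pd: "smooth f \<Longrightarrow> smooth (pd i f)"
  unfolding smooth_def
proof (intro allI)
  fix "is" x assume "\<forall>is x. foldr pd is f differentiable at x"
  then have "foldr pd (is @ [i]) f differentiable at x" by blast
  then show "foldr pd is (pd i f) differentiable at x" by simp
qed

lemma smooth_coinduct:
  assumes "P f" and "\<And>f x. P f \<Longrightarrow> f differentiable at x" and "\<And>f i. P f \<Longrightarrow> P (pd i f)"
  shows "smooth f"
proof -
  have "P (foldr pd is f)" for "is" by (induction "is") (use assms in auto)
  then show ?thesis unfolding smooth_def using assms(2) by blast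
qed

text \<open>A partial derivative of a product is a sum of products, so products alone do not reproduce
themselves under differentiation. The class generated by the smooth functions under sums and
products does, and it consists of differentiable functions; hence all its members are smooth.\<close>

inductive smooth_alg :: "(real^'n::finite \<Rightarrow> real) \<Rightarrow> bool" where
  base: "smooth f \<Longrightarrow> smooth_alg f"
| add: "smooth_alg f \<Longrightarrow> smooth_alg g \<Longrightarrow> smooth_alg (\<lambda>x. f x + g x)"
| mult: "smooth_alg f \<Longrightarrow> smooth_alg g \<Longrightarrow> smooth_alg (\<lambda>x. f x * g x)"

lemma smooth_alg_differentiable: "smooth_alg f \<Longrightarrow> f differentiable at x"
  by (induction rule: smooth_alg.induct)
    (auto intro: smooth_differentiable differentiable_add differentiable_mult)

lemma smooth_alg_pd: "smooth_alg f \<Longrightarrow> smooth_alg (pd i f)"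
proof (induction rule: smooth_alg.induct)
  case (base f) then show ?case by (simp add: smooth_alg.base smooth_pd)
next
  case (add f g)
  then have "pd i (\<lambda>x. f x + g x) = (\<lambda>x. pd i f x + pd i g x)"
    by (intro ext pd_add smooth_alg_differentiable)
  with add show ?case by (simp add: smooth_alg.add)
next
  case (mult f g)
  then have "pd i (\<lambda>x. f x * g x) = (\<lambda>x. f x * pd i g x + pd i f x * g x)"
    by (intro ext pd_mult smooth_alg_differentiable)
  with mult show ?case by (simp add: smooth_alg.add smooth_alg.mult)
qed

lemma smooth_alg_smooth: "smooth_alg f \<Longrightarrow> smooth f"
  by (rule smooth_coinduct[where P = smooth_alg]) (auto intro: smooth_alg_differentiable smooth_alg_pd)

lemma smooth_add: "smooth f \<Longrightarrow> smooth g \<Longrightarrow> smooth (\<lambda>x. f x + g x)"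
  and smooth_mult: "smooth f \<Longrightarrow> smooth g \<Longrightarrow> smooth (\<lambda>x. f x * g x)"
  by (auto intro!: smooth_alg_smooth intro: smooth_alg.intros)

lemma smooth_const: "smooth (\<lambda>x. c)"
proof (rule smooth_coinduct[where P = "\<lambda>f. \<exists>c. f = (\<lambda>x. c)"])
  fix f :: "real^'n \<Rightarrow> real" and i assume "\<exists>c. f = (\<lambda>x. c)"
  then show "\<exists>c. pd i f = (\<lambda>x. c)" by (metis pd_const)
qed auto

lemma smooth_coord: "smooth (\<lambda>x. x $ j)" for j :: "'n::finite"
proof (rule smooth_coinduct[where P = "\<lambda>f. smooth f \<or> f = (\<lambda>x. x $ j)"])
  fix f and x :: "real^'n" assume "smooth f \<or> f = (\<lambda>x. x $ j)"
  then show "f differentiable at x"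
    using bounded_linear_imp_differentiable[OF bounded_linear_vec_nth] smooth_differentiable by blast
next
  fix f and i :: 'n assume "smooth f \<or> f = (\<lambda>x. x $ j)"
  then show "smooth (pd i f) \<or> pd i f = (\<lambda>x. x $ j)"
    by (auto simp: pd_coord smooth_pd smooth_const)
qed simp

lemma smooth_exp: "smooth (\<lambda>x. exp (c \<bullet> x))" for c :: "real^'n::finite"
proof -
  define P where "P f \<longleftrightarrow> (\<exists>a. f = (\<lambda>x. a * exp (c \<bullet> x)))" for f
  have diff: "(\<lambda>y. exp (c \<bullet> y)) differentiable at x" for x
    using exp_inner_has_derivative differentiable_def by blast
  have "smooth f" if "P f" for f
  proof (rule smooth_coinduct[where P = P, OF that])
    fix f x assume "P f" then show "f differentiable at x"
      unfolding P_def using diff by (auto intro: differentiable_mult)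
  next
    fix f i assume "P f"
    then obtain a where f: "f = (\<lambda>x. a * exp (c \<bullet> x))" unfolding P_def by blast
    have "pd i f = (\<lambda>x. (a * c $ i) * exp (c \<bullet> x))"
      unfolding f by (rule ext, subst pd_mult) (auto simp: diff pd_exp)
    then show "P (pd i f)" unfolding P_def by blast
  qed
  then show ?thesis unfolding P_def by (metis mult_1)
qed

lemma mean_value_axis:
  assumes "\<And>y. f differentiable at y" and "h > 0"
  obtains s where "0 < s" "s < h" "f (x + h *\<^sub>R axis i 1) - f x = h * pd i f (x + s *\<^sub>R axis i 1)"
proof -
  have d: "((\<lambda>s. f (x + s *\<^sub>R axis i 1)) has_real_derivative pd i f (x + s *\<^sub>R axis i 1)) (at s)" for s
  proof -
    let ?D = "frechet_derivative f (at (x + s *\<^sub>R axis i 1))"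
    have D: "(f has_derivative ?D) (at (x + s *\<^sub>R axis i 1))"
      using assms(1) frechet_derivative_works by blast
    have "((\<lambda>s. x + s *\<^sub>R axis i 1) has_derivative (\<lambda>h. h *\<^sub>R axis i 1)) (at s)"
      by (auto intro!: derivative_eq_intros)
    from has_derivative_compose[OF this D]
    have "((\<lambda>s. f (x + s *\<^sub>R axis i 1)) has_derivative (\<lambda>h. ?D (h *\<^sub>R axis i 1))) (at s)" by simp
    moreover have "?D (h *\<^sub>R axis i 1) = pd i f (x + s *\<^sub>R axis i 1) * h" for h
      using linear_cmul[OF has_derivative_linear[OF D]] by (simp add: pd_def mult.commute)
    ultimately show ?thesis by (simp add: has_field_derivative_def)
  qed
  obtain s where "0 < s" "s < h"
      "f (x + h *\<^sub>R axis i 1) - f (x + 0 *\<^sub>R axis i 1) = (h - 0) * pd i f (x + s *\<^sub>R axis i 1)"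
    using MVT2[OF \<open>h > 0\<close> d] by blast
  then show ?thesis using that by simp
qed

lemma differentiable_shift_diff:
  assumes "\<And>y. f differentiable at y"
  shows "(\<lambda>y. f (y + v) - f y) differentiable at y"
    and "pd i (\<lambda>y. f (y + v) - f y) y = pd i f (y + v) - pd i f y"
proof -
  have "((\<lambda>y. y + v) has_derivative (\<lambda>h. h)) (at y)" by (auto intro!: derivative_eq_intros)
  moreover have "(f has_derivative frechet_derivative f (at (y + v))) (at (y + v))"
    using assms frechet_derivative_works by blast
  ultimately have "((\<lambda>y. f (y + v)) has_derivative frechet_derivative f (at (y + v))) (at y)"
    by (rule has_derivative_compose)
  moreover have "(f has_derivative frechet_derivative f (at y)) (at y)"
    using assms frechet_derivative_works by blast
  ultimately have *: "((\<lambda>y. f (y + v) - f y) has_derivative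
      (\<lambda>h. frechet_derivative f (at (y + v)) h - frechet_derivative f (at y) h)) (at y)"
    by (rule has_derivative_diff)
  show "(\<lambda>y. f (y + v) - f y) differentiable at y" using * differentiable_def by blast
  show "pd i (\<lambda>y. f (y + v) - f y) y = pd i f (y + v) - pd i f y"
    by (subst pd_eq[OF *]) (simp add: pd_def)
qed

text \<open>The mixed second difference over a small square is the mean value theorem applied once in each
direction, which yields a value of the mixed second derivative near the corner. The difference is
symmetric in the two directions; letting the square shrink gives the symmetry of second
derivatives in \<open>pd_commute\<close>.\<close>

lemma second_difference:
  assumes "smooth f" and "h > 0"
  obtains y where "norm (y - x) < 2 * h"
    "f (x + h *\<^sub>R axis i 1 + h *\<^sub>R axis j 1) - f (x + h *\<^sub>R axis i 1) - (f (x + h *\<^sub>R axis j 1) - f x)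
       = h * h * pd j (pd i f) y"
proof -
  have d: "\<And>y. f differentiable at y" "\<And>y. pd i f differentiable at y"
    using assms(1) by (auto intro: smooth_differentiable smooth_pd)
  define g where "g y = f (y + h *\<^sub>R axis j 1) - f y" for y
  have gd: "\<And>y. g differentiable at y" unfolding g_def using differentiable_shift_diff(1) d(1) by blast
  have gp: "\<And>y. pd i g y = pd i f (y + h *\<^sub>R axis j 1) - pd i f y"
    unfolding g_def using differentiable_shift_diff(2) d(1) by blast
  obtain s where s: "0 < s" "s < h" "g (x + h *\<^sub>R axis i 1) - g x = h * pd i g (x + s *\<^sub>R axis i 1)"
    using mean_value_axis[OF gd \<open>h > 0\<close>] by blast
  obtain r where r: "0 < r" "r < h"
      "pd i f (x + s *\<^sub>R axis i 1 + h *\<^sub>R axis j 1) - pd i f (x + s *\<^sub>R axis i 1)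
         = h * pd j (pd i f) (x + s *\<^sub>R axis i 1 + r *\<^sub>R axis j 1)"
    using mean_value_axis[OF d(2) \<open>h > 0\<close>] by blast
  have "norm (s *\<^sub>R axis i 1 + r *\<^sub>R axis j (1::real) :: real^'a) \<le> s + r"
    by (rule order_trans[OF norm_triangle_ineq]) (use s r in \<open>simp add: norm_axis_1\<close>)
  with s r have "norm ((x + s *\<^sub>R axis i 1 + r *\<^sub>R axis j 1) - x) < 2 * h" by (simp add: add.assoc)
  with s(3) r(3) gp show ?thesis
    by (intro that[of "x + s *\<^sub>R axis i 1 + r *\<^sub>R axis j 1"]) (auto simp: g_def)
qed

lemma pd_commute:
  assumes "smooth f"
  shows "pd i (pd j f) = pd j (pd i f)"
proof (rule ext, rule ccontr)
  fix x assume ne: "pd i (pd j f) x \<noteq> pd j (pd i f) x"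
  define e where "e = \<bar>pd i (pd j f) x - pd j (pd i f) x\<bar> / 2"
  have "e > 0" using ne by (simp add: e_def)
  have c: "isCont (pd i (pd j f)) x" "isCont (pd j (pd i f)) x"
    using assms by (auto intro!: differentiable_imp_continuous_within smooth_differentiable smooth_pd)
  obtain d1 where d1: "d1 > 0" "\<And>y. norm (y - x) < d1 \<Longrightarrow> \<bar>pd i (pd j f) y - pd i (pd j f) x\<bar> < e"
    using c(1) \<open>e > 0\<close> unfolding continuous_at_eps_delta dist_norm by (metis real_norm_def)
  obtain d2 where d2: "d2 > 0" "\<And>y. norm (y - x) < d2 \<Longrightarrow> \<bar>pd j (pd i f) y - pd j (pd i f) x\<bar> < e"
    using c(2) \<open>e > 0\<close> unfolding continuous_at_eps_delta dist_norm by (metis real_norm_def)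
  define h where "h = min d1 d2 / 2"
  have h: "h > 0" "2 * h \<le> d1" "2 * h \<le> d2" using d1 d2 by (auto simp: h_def)
  obtain y where y: "norm (y - x) < 2 * h"
    "f (x + h *\<^sub>R axis i 1 + h *\<^sub>R axis j 1) - f (x + h *\<^sub>R axis i 1) - (f (x + h *\<^sub>R axis j 1) - f x)
       = h * h * pd j (pd i f) y"
    using second_difference[OF assms h(1)] by blast
  obtain z where z: "norm (z - x) < 2 * h"
    "f (x + h *\<^sub>R axis j 1 + h *\<^sub>R axis i 1) - f (x + h *\<^sub>R axis j 1) - (f (x + h *\<^sub>R axis i 1) - f x)
       = h * h * pd i (pd j f) z"
    using second_difference[OF assms h(1)] by blast
  \<comment> \<open>The two mean values come from the same second difference.\<close>
  have swap: "x + h *\<^sub>R axis j 1 + h *\<^sub>R axis i 1 = x + h *\<^sub>R axis i 1 + h *\<^sub>R axis j 1" by simp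
  have "h * h * pd j (pd i f) y = h * h * pd i (pd j f) z"
    using y(2) z(2)[unfolded swap] by linarith
  then have "pd j (pd i f) y = pd i (pd j f) z" using h(1) by simp
  moreover have "\<bar>pd i (pd j f) z - pd i (pd j f) x\<bar> < e" using d1(2) z(1) h by simp
  moreover have "\<bar>pd j (pd i f) y - pd j (pd i f) x\<bar> < e" using d2(2) y(1) h by simp
  ultimately show False unfolding e_def by (smt (verit) field_sum_of_halves)
qed

section \<open>Derivations, the ring of smooth functions, and symbols\<close>

definition derivation :: "('a::comm_ring_1 \<Rightarrow> 'a) \<Rightarrow> bool" where
  "derivation d \<longleftrightarrow> (\<forall>p q. d (p + q) = d p + d q) \<and> (\<forall>p q. d (p * q) = d p * q + p * d q)"

lemma derivation_add: "derivation d \<Longrightarrow> d (p + q) = d p + d q"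
  and derivation_mult: "derivation d \<Longrightarrow> d (p * q) = d p * q + p * d q"
  by (auto simp: derivation_def)

lemma derivation_zero: "derivation d \<Longrightarrow> d 0 = 0"
  using derivation_add[of d 0 0] by simp

lemma derivation_one: "derivation d \<Longrightarrow> d 1 = 0"
  using derivation_mult[of d 1 1] by simp

lemma derivation_uminus: "derivation d \<Longrightarrow> d (- p) = - d p"
  using derivation_add[of d p "- p"] derivation_zero[of d] by (simp add: eq_neg_iff_add_eq_0 add.commute)

lemma derivation_diff: "derivation d \<Longrightarrow> d (p - q) = d p - d q"
  using derivation_add[of d p "- q"] derivation_uminus[of d q] by simp

lemma derivation_sum: "derivation d \<Longrightarrow> d (\<Sum>i\<in>I. f i) = (\<Sum>i\<in>I. d (f i))"
  by (induction I rule: infinite_finite_induct) (auto simp: derivation_zero derivation_add)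

lemma derivation_power: "derivation d \<Longrightarrow> d (p ^ k) = of_nat k * p ^ (k - 1) * d p"
proof (induction k)
  case (Suc k)
  then show ?case by (cases k) (auto simp: derivation_mult algebra_simps)
qed (simp add: derivation_one)

text \<open>With the smooth functions as a commutative ring, on which the partial derivatives are commuting
derivations, all commutator computations below are identities of ring elements.\<close>

typedef (overloaded) ('n::finite) sfun = "{f :: real^'n \<Rightarrow> real. smooth f}"
  morphisms sf_apply sf_Abs
  by (rule exI[of _ "\<lambda>x. 0"]) (simp add: smooth_const)

setup_lifting type_definition_sfun

lemma sf_smooth [simp]: "smooth (sf_apply F)" using sf_apply by auto

lemma sf_eqI: "(\<And>x. sf_apply F x = sf_apply G x) \<Longrightarrow> F = G"
  by (simp add: sf_apply_inject[symmetric] fun_eq_iff)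

instantiation sfun :: (finite) comm_ring_1
begin
lift_definition zero_sfun :: "'a sfun" is "\<lambda>x. 0" by (rule smooth_const)
lift_definition one_sfun :: "'a sfun" is "\<lambda>x. 1" by (rule smooth_const)
lift_definition plus_sfun :: "'a sfun \<Rightarrow> 'a sfun \<Rightarrow> 'a sfun" is "\<lambda>f g x. f x + g x" by (rule smooth_add)
lift_definition times_sfun :: "'a sfun \<Rightarrow> 'a sfun \<Rightarrow> 'a sfun" is "\<lambda>f g x. f x * g x" by (rule smooth_mult)
lift_definition uminus_sfun :: "'a sfun \<Rightarrow> 'a sfun" is "\<lambda>f x. - f x"
  using smooth_mult[OF smooth_const[of "-1"]] by simp
definition minus_sfun :: "'a sfun \<Rightarrow> 'a sfun \<Rightarrow> 'a sfun" where "minus_sfun F G = F + - G"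
instance
proof
  fix F G H :: "'a sfun"
  show "F * G * H = F * (G * H)" by transfer (simp add: mult.assoc)
  show "F * G = G * F" by transfer (simp add: mult.commute)
  show "1 * F = F" by transfer simp
  show "F + G + H = F + (G + H)" by transfer (simp add: add.assoc)
  show "F + G = G + F" by transfer (simp add: add.commute)
  show "0 + F = F" by transfer simp
  show "- F + F = 0" by transfer simp
  show "F - G = F + - G" by (rule minus_sfun_def)
  show "(F + G) * H = F * H + G * H" by transfer (simp add: distrib_right)
  show "(0 :: 'a sfun) \<noteq> 1" by transfer (simp add: fun_eq_iff)
qed
end

lift_definition sf_const :: "real \<Rightarrow> 'n::finite sfun" is "\<lambda>c x. c" by (rule smooth_const)
lift_definition sf_coord :: "'n \<Rightarrow> 'n::finite sfun" is "\<lambda>j x. x $ j" by (rule smooth_coord)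
lift_definition sf_pd :: "'n \<Rightarrow> 'n::finite sfun \<Rightarrow> 'n sfun" is pd by (rule smooth_pd)

lemma sf_simps [simp]:
  "sf_apply 0 x = 0" "sf_apply 1 x = 1" "sf_apply (F + G) x = sf_apply F x + sf_apply G x"
  "sf_apply (F * G) x = sf_apply F x * sf_apply G x" "sf_apply (- F) x = - sf_apply F x"
  "sf_apply (sf_const c) x = c" "sf_apply (sf_coord j) x = x $ j" "sf_apply (sf_pd i F) = pd i (sf_apply F)"
  by (simp_all add: zero_sfun.rep_eq one_sfun.rep_eq plus_sfun.rep_eq times_sfun.rep_eq
      uminus_sfun.rep_eq sf_const.rep_eq sf_coord.rep_eq sf_pd.rep_eq)

lemma sf_minus [simp]: "sf_apply (F - G) x = sf_apply F x - sf_apply G x"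
  unfolding minus_sfun_def by (simp only: sf_simps diff_conv_add_uminus)

lemma sf_sum [simp]: "sf_apply (\<Sum>i\<in>I. F i) x = (\<Sum>i\<in>I. sf_apply (F i) x)"
  by (induction I rule: infinite_finite_induct) auto

lemma sf_const_simps: "sf_const 0 = 0" "sf_const 1 = 1" "sf_const (a + b) = sf_const a + sf_const b" "sf_const (a * b) = sf_const a * sf_const b"
    "sf_const (- a) = - sf_const a" "sf_const (a - b) = sf_const a - sf_const b"
  by (auto intro!: sf_eqI)

lemma sf_pd_derivation: "derivation (sf_pd i)"
proof -
  have d: "sf_apply F differentiable at x" for F :: "'a sfun" and x
    by (rule smooth_differentiable[OF sf_smooth])
  have "sf_pd i (F + G) = sf_pd i F + sf_pd i G" for F G :: "'a sfun"
  proof (rule sf_eqI)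
    fix x show "sf_apply (sf_pd i (F + G)) x = sf_apply (sf_pd i F + sf_pd i G) x"
      using pd_add[OF d d] by (simp add: plus_sfun.rep_eq)
  qed
  moreover have "sf_pd i (F * G) = sf_pd i F * G + F * sf_pd i G" for F G :: "'a sfun"
  proof (rule sf_eqI)
    fix x show "sf_apply (sf_pd i (F * G)) x = sf_apply (sf_pd i F * G + F * sf_pd i G) x"
      using pd_mult[OF d d] by (simp add: times_sfun.rep_eq)
  qed
  ultimately show ?thesis unfolding derivation_def by blast
qed

lemmas sf_pd_add = derivation_add[OF sf_pd_derivation]
  and sf_pd_mult = derivation_mult[OF sf_pd_derivation]
  and sf_pd_sum = derivation_sum[OF sf_pd_derivation]
  and sf_pd_diff = derivation_diff[OF sf_pd_derivation]

lemma sf_pd_const [simp]: "sf_pd i (sf_const c) = 0"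
  by (rule sf_eqI) (simp add: sf_const.rep_eq)

lemma sf_pd_coord: "sf_pd i (sf_coord j) = sf_const (if i = j then 1 else 0)"
  by (rule sf_eqI) (simp add: sf_coord.rep_eq pd_coord)

lemma sf_pd_commute: "sf_pd i (sf_pd j F) = sf_pd j (sf_pd i F)"
  by (rule sf_eqI) (simp only: sf_simps pd_commute[OF sf_smooth, of i j])

lemma sf_pd_const_mult: "sf_pd i (sf_const c * F) = sf_const c * sf_pd i F"
  by (simp add: sf_pd_mult)

lemma smooth_foldr_pd: "smooth f \<Longrightarrow> smooth (foldr pd is f)"
  by (induction "is") (auto intro: smooth_pd)

lift_definition sf_multi_pd :: "('n \<Rightarrow> nat) \<Rightarrow> 'n::finite sfun \<Rightarrow> 'n sfun" is multi_pd
  unfolding multi_pd_def by (rule smooth_foldr_pd)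

lemma foldr_pd_remove1: "j \<in> set xs \<Longrightarrow> foldr sf_pd xs F = sf_pd j (foldr sf_pd (remove1 j xs) F)"
proof (induction xs)
  case (Cons x xs)
  show ?case
  proof (cases "x = j")
    case False
    then have "foldr sf_pd (x # xs) F = sf_pd x (sf_pd j (foldr sf_pd (remove1 j xs) F))" using Cons by simp
    then show ?thesis using False by (simp add: sf_pd_commute[of x j])
  qed simp
qed simp

lemma foldr_pd_mset: "mset xs = mset ys \<Longrightarrow> foldr sf_pd xs F = foldr sf_pd ys F"
proof (induction xs arbitrary: ys)
  case (Cons x xs)
  then have x: "x \<in> set ys" by (metis list.set_intros(1) set_mset_mset)
  have "mset xs = mset (remove1 x ys)" by (simp add: Cons.prems[symmetric])
  then have "foldr sf_pd xs F = foldr sf_pd (remove1 x ys) F" by (rule Cons.IH)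
  then show ?case using foldr_pd_remove1[OF x] by simp
qed simp

lemma sf_foldr_pd: "sf_apply (foldr sf_pd xs F) = foldr pd xs (sf_apply F)"
  by (induction xs) auto

lemma ex_list_count: "\<exists>xs. \<forall>i. count_list xs i = k i" for k :: "'n::finite \<Rightarrow> nat"
proof -
  obtain ys :: "'n list" where ys: "set ys = UNIV" "distinct ys"
    using finite_distinct_list[OF finite] by blast
  have rep: "count_list (replicate m a) b = (if a = b then m else 0)" for m and a b :: 'n
    by (induction m) auto
  have "count_list (concat (map (\<lambda>j. replicate (k j) j) zs)) i = (if i \<in> set zs then k i else 0)"
    if "distinct zs" for zs i
    using that by (induction zs) (auto simp: rep)
  with ys show ?thesis by (metis UNIV_I)
qed

text \<open>Since partial derivatives commute, every list with the right multiplicities computes the same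
iterated derivative, in particular the one picked by the choice operator in \<open>multi_pd\<close>.\<close>

lemma sf_multi_pd_foldr:
  assumes "\<forall>i. count_list xs i = k i"
  shows "sf_multi_pd k F = foldr sf_pd xs F"
proof -
  define ys where "ys = (SOME xs. \<forall>i. count_list xs i = k i)"
  have "\<forall>i. count_list ys i = k i" unfolding ys_def by (rule someI_ex) (rule ex_list_count)
  with assms have "mset xs = mset ys" by (intro multiset_eqI) (simp add: count_mset)
  then have "foldr sf_pd xs F = foldr sf_pd ys F" by (rule foldr_pd_mset)
  then show ?thesis
    by (intro sf_eqI) (simp add: sf_multi_pd.rep_eq multi_pd_def ys_def sf_foldr_pd)
qed

lemma sf_multi_pd_zero: "sf_multi_pd (\<lambda>i. 0) F = F"
  using sf_multi_pd_foldr[of "[]" "\<lambda>i. 0"] by simp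

lemma sf_multi_pd_Suc: "sf_multi_pd (k(i := Suc (k i))) F = sf_multi_pd k (sf_pd i F)"
proof -
  obtain xs where xs: "\<forall>j. count_list xs j = k j" using ex_list_count by blast
  then have "\<forall>j. count_list (xs @ [i]) j = (k(i := Suc (k i))) j" by auto
  from sf_multi_pd_foldr[OF this] sf_multi_pd_foldr[OF xs] show ?thesis by (simp del: fun_upd_apply)
qed

lemma poly_induct:
  fixes p :: "'a \<Rightarrow>\<^sub>0 'b::comm_monoid_add"
  assumes "\<And>k c. P (Poly_Mapping.single k c)" and "\<And>p q. P p \<Longrightarrow> P q \<Longrightarrow> P (p + q)"
  shows "P p"
proof -
  have "P (\<Sum>k\<in>K. Poly_Mapping.single k (Poly_Mapping.lookup p k))" if "finite K" for K
    using that
  proof (induction K)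
    case empty
    show ?case using assms(1)[of undefined 0] by simp
  qed (use assms in auto)
  moreover have "(\<Sum>k\<in>Poly_Mapping.keys p. Poly_Mapping.single k (Poly_Mapping.lookup p k)) = p"
    by (rule poly_mapping_eqI) (simp add: lookup_sum lookup_single when_def in_keys_iff)
  ultimately show ?thesis by (metis finite_keys)
qed

lemma var_mult_single:
  "var s i * Poly_Mapping.single m c = Poly_Mapping.single (Poly_Mapping.single (s, i) 1 + m) c"
  by (simp add: var_def mult_single)

lemma const_mult_single: "const c * Poly_Mapping.single m d = Poly_Mapping.single m (c * d)"
  by (simp add: const_def mult_single)

lemma const_simps: "const 0 = 0" "const 1 = 1" "const (a + b) = const a + const b"
    "const (a * b) = const a * const b" "const (- a) = - const a"
  by (simp_all add: const_def single_add mult_single single_uminus)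

lemma const_of_nat: "const (real k) = of_nat k"
  by (induction k) (auto simp: const_simps)

lemma const_numeral: "const (numeral k) = numeral k"
  by (simp add: const_def)

lemma symbol_induct [case_names const var add]:
  fixes S :: "'n symbol"
  assumes c: "\<And>c. P (const c)" and v: "\<And>s i S. P S \<Longrightarrow> P (var s i * S)"
    and a: "\<And>S T. P S \<Longrightarrow> P T \<Longrightarrow> P (S + T)"
  shows "P S"
proof (induction S rule: poly_induct)
  case (1 m c)
  have "\<forall>S. P S \<longrightarrow> P (Poly_Mapping.single m 1 * S)"
  proof (induction m rule: poly_induct)
    case (1 w k)
    obtain s i where w: "w = (s, i)" by (cases w)
    show ?case
    proof (induction k)
      case (Suc k)
      have "Poly_Mapping.single (Poly_Mapping.single w (Suc k)) 1
          = var s i * Poly_Mapping.single (Poly_Mapping.single w k) 1"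
        by (simp add: var_mult_single w single_add[symmetric])
      then have "Poly_Mapping.single (Poly_Mapping.single w (Suc k)) 1 * S
          = var s i * (Poly_Mapping.single (Poly_Mapping.single w k) 1 * S)" for S
        by (simp only: mult.assoc)
      then show ?case using Suc v by simp
    qed simp
  next
    case (2 m m')
    have "Poly_Mapping.single (m + m') 1 = (Poly_Mapping.single m 1 * Poly_Mapping.single m' 1 :: 'n symbol)"
      by (simp add: mult_single)
    then show ?case using 2 by (simp only: mult.assoc) blast
  qed
  from this[rule_format, OF c] have "P (Poly_Mapping.single m 1 * const c)" .
  then show ?case by (simp add: const_def mult_single)
qed (rule a)

definition der :: "slot \<Rightarrow> 'n \<Rightarrow> 'n symbol \<Rightarrow> 'n symbol" where
  "der s i S = (\<Sum>m\<in>Poly_Mapping.keys S.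
     Poly_Mapping.single (m - Poly_Mapping.single (s, i) 1)
       (Poly_Mapping.lookup S m * real (Poly_Mapping.lookup m (s, i))))"

lemma der_add: "der s i (S + T) = der s i S + der s i T"
  unfolding der_def by (rule setsum_keys_plus_distrib) (auto simp: single_add distrib_right)

lemma der_single: "der s i (Poly_Mapping.single m c) =
    Poly_Mapping.single (m - Poly_Mapping.single (s, i) 1) (c * real (Poly_Mapping.lookup m (s, i)))"
  by (auto simp: der_def)

lemma der_const [simp]: "der s i (const c) = 0"
  by (simp add: const_def der_single)

lemma der_const_mult: "der s i (const c * S) = const c * der s i S"
  by (induction S rule: poly_induct)
    (auto simp: const_mult_single der_single der_add distrib_left mult.assoc)

lemma der_var_mult:
  "der s i (var t j * S) = (if s = t \<and> i = j then S else 0) + var t j * der s i S"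
proof (induction S rule: poly_induct)
  case (1 m c)
  have eq: "Poly_Mapping.single (t, j) 1 + m - Poly_Mapping.single (s, i) 1
      = Poly_Mapping.single (t, j) 1 + (m - Poly_Mapping.single (s, i) (1::nat))"
    if "Poly_Mapping.lookup m (s, i) \<noteq> 0"
    using that by (intro poly_mapping_eqI) (auto simp: lookup_add lookup_minus lookup_single when_def)
  show ?case
  proof (cases "Poly_Mapping.lookup m (s, i) = 0")
    case True
    then show ?thesis
      by (auto simp: var_mult_single der_single lookup_add lookup_single when_def)
  next
    case False
    have "Poly_Mapping.single (s, i) 1 + (m - Poly_Mapping.single (s, i) (1::nat)) = m"
      using False by (intro poly_mapping_eqI) (auto simp: lookup_add lookup_minus lookup_single when_def)
    then show ?thesis using False eq
      by (auto simp: var_mult_single der_single lookup_add lookup_single when_def single_add distrib_left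
          add.commute)
  qed
qed (auto simp: distrib_left der_add)

lemma der_derivation: "derivation (der s i)"
proof -
  have "der s i (S * T) = der s i S * T + S * der s i T" for S T
  proof (induction S rule: symbol_induct)
    case (var t j S)
    then show ?case by (simp add: mult.assoc der_var_mult distrib_left distrib_right)
  qed (auto simp: der_const_mult der_add distrib_right)
  then show ?thesis by (simp add: derivation_def der_add)
qed

lemma der_var: "der s i (var t j) = (if s = t \<and> i = j then 1 else 0)"
  using der_var_mult[of s i t j 1] derivation_one[OF der_derivation, of s i] by simp

lemmas der_mult = derivation_mult[OF der_derivation]
  and der_sum = derivation_sum[OF der_derivation]
  and der_zero [simp] = derivation_zero[OF der_derivation]

text \<open>The operator of a symbol on smooth functions. Its three arguments are collected into one family
indexed by slots, so that a change of the argument in one slot is a function update and every slot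
is treated alike.\<close>

definition sf_op :: "'n symbol \<Rightarrow> (slot \<Rightarrow> 'n::finite sfun) \<Rightarrow> 'n sfun" where
  "sf_op S f = (\<Sum>m\<in>Poly_Mapping.keys S. sf_const (Poly_Mapping.lookup S m)
        * sf_multi_pd (\<lambda>i. Poly_Mapping.lookup m (Xi, i)) (f Xi)
        * sf_multi_pd (\<lambda>i. Poly_Mapping.lookup m (Eta, i)) (f Eta)
        * sf_multi_pd (\<lambda>i. Poly_Mapping.lookup m (Zeta, i)) (f Zeta))"

lemma symbol_op_op:
  "symbol_op S (sf_apply (f Xi)) (sf_apply (f Eta)) (sf_apply (f Zeta)) = sf_apply (sf_op S f)"
  by (rule ext) (simp add: sf_op_def symbol_op_def sf_multi_pd.rep_eq)

lemma sf_op_add: "sf_op (S + T) f = sf_op S f + sf_op T f"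
  unfolding sf_op_def by (rule setsum_keys_plus_distrib) (auto simp: sf_const_simps distrib_right)

lemma sf_op_single: "sf_op (Poly_Mapping.single m c) f = sf_const c
        * sf_multi_pd (\<lambda>i. Poly_Mapping.lookup m (Xi, i)) (f Xi)
        * sf_multi_pd (\<lambda>i. Poly_Mapping.lookup m (Eta, i)) (f Eta)
        * sf_multi_pd (\<lambda>i. Poly_Mapping.lookup m (Zeta, i)) (f Zeta)"
  by (auto simp: sf_op_def sf_const_simps)

lemma sf_op_const: "sf_op (const c) f = sf_const c * f Xi * f Eta * f Zeta"
  by (simp add: const_def sf_op_single sf_multi_pd_zero)

lemma sf_op_const_mult: "sf_op (const c * S) f = sf_const c * sf_op S f"
  by (induction S rule: poly_induct)
    (auto simp: const_mult_single sf_op_single sf_op_add distrib_left sf_const_simps mult.assoc)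

lemma sf_op_zero [simp]: "sf_op 0 f = 0" by (simp add: sf_op_def)

lemma sf_op_uminus: "sf_op (- S) f = - sf_op S f"
  using sf_op_add[of S "- S" f] by (simp add: eq_neg_iff_add_eq_0 add.commute)

lemma sf_op_diff: "sf_op (S - T) f = sf_op S f - sf_op T f"
  using sf_op_add[of S "- T" f] by (simp add: sf_op_uminus)

lemma sf_op_sum: "sf_op (\<Sum>i\<in>I. S i) f = (\<Sum>i\<in>I. sf_op (S i) f)"
  by (induction I rule: infinite_finite_induct) (auto simp: sf_op_add)

text \<open>Multiplication of a symbol by a variable is differentiation of one argument before the operator is
applied. Together with linearity this determines the operator of every symbol, and it turns
\<open>symbol_induct\<close> into a method of proof for statements about \<open>sf_op\<close>.\<close>

lemma sf_op_var_mult: "sf_op (var s i * S) f = sf_op S (f(s := sf_pd i (f s)))"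
proof (induction S rule: poly_induct)
  case (1 m c)
  let ?m = "Poly_Mapping.single (s, i) 1 + m"
  have "(\<lambda>j. Poly_Mapping.lookup ?m (t, j)) =
      (if t = s then (\<lambda>j. Poly_Mapping.lookup m (t, j))(i := Suc (Poly_Mapping.lookup m (t, i)))
       else (\<lambda>j. Poly_Mapping.lookup m (t, j)))" for t
    by (auto simp: lookup_add lookup_single when_def fun_eq_iff)
  then have "sf_multi_pd (\<lambda>j. Poly_Mapping.lookup ?m (t, j)) F =
      sf_multi_pd (\<lambda>j. Poly_Mapping.lookup m (t, j)) (if t = s then sf_pd i F else F)" for t F
    using sf_multi_pd_Suc[of "\<lambda>j. Poly_Mapping.lookup m (t, j)" i F] by auto
  then show ?case by (simp add: var_mult_single sf_op_single)
qed (auto simp: distrib_left sf_op_add)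

lemma sf_op_slot_add: "sf_op S (f(s := F + G)) = sf_op S (f(s := F)) + sf_op S (f(s := G))"
proof (induction S arbitrary: f F G rule: symbol_induct)
  case (const c)
  then show ?case by (cases s) (auto simp: sf_op_const algebra_simps)
next
  case (var t i S)
  then show ?case by (cases "s = t") (simp_all add: sf_op_var_mult sf_pd_add fun_upd_twist[of s t] del: fun_upd_apply add: fun_upd_same fun_upd_other)
next
  case (add S T)
  then show ?case by (simp add: sf_op_add)
qed

lemma sf_op_slot_const: "sf_op S (f(s := sf_const c * F)) = sf_const c * sf_op S (f(s := F))"
proof (induction S arbitrary: f F rule: symbol_induct)
  case (const d)
  then show ?case by (cases s) (auto simp: sf_op_const algebra_simps)
next
  case (var t i S)
  then show ?case by (cases "s = t") (simp_all add: sf_op_var_mult sf_pd_const_mult fun_upd_twist[of s t] del: fun_upd_apply add: fun_upd_same fun_upd_other)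
next
  case (add S T)
  then show ?case by (simp add: sf_op_add distrib_left)
qed

text \<open>The Heisenberg relation: the commutator of a constant-coefficient operator with multiplication of
an argument by a coordinate is the operator of the derivative of its symbol. This is how the
non-constant coefficients of the conformal fields reach the symbol.\<close>

lemma sf_op_slot_coord:
  "sf_op S (f(s := sf_coord i * F)) = sf_coord i * sf_op S (f(s := F)) + sf_op (der s i S) (f(s := F))"
proof (induction S arbitrary: f F rule: symbol_induct)
  case (const d)
  then show ?case by (cases s) (auto simp: sf_op_const algebra_simps)
next
  case (var t j S)
  show ?case
  proof (cases "s = t")
    case True
    have "sf_pd j (sf_coord i * F) = sf_const (if i = j then 1 else 0) * F + sf_coord i * sf_pd j F"
      by (simp add: sf_pd_mult sf_pd_coord)
    then have "sf_op (var t j * S) (f(s := sf_coord i * F))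
        = sf_const (if i = j then 1 else 0) * sf_op S (f(s := F)) + sf_op S (f(s := sf_coord i * sf_pd j F))"
      using True by (simp add: sf_op_var_mult sf_op_slot_add sf_op_slot_const del: fun_upd_apply add: fun_upd_same fun_upd_other)
    then show ?thesis using True
      by (auto simp: var[unfolded True] der_var_mult sf_op_add sf_op_var_mult sf_const_simps add_ac simp del: fun_upd_apply simp add: fun_upd_same fun_upd_other)
  next
    case False
    then show ?thesis
      by (simp add: sf_op_var_mult der_var_mult fun_upd_twist[of s t] var del: fun_upd_apply add: fun_upd_same fun_upd_other)
  qed
next
  case (add S T)
  then show ?case by (simp add: sf_op_add der_add distrib_left)
qed

lemma sf_pd_op: "sf_pd i (sf_op S f) = sf_op (var Xi i * S) f + sf_op (var Eta i * S) f + sf_op (var Zeta i * S) f"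
proof (induction S arbitrary: f rule: symbol_induct)
  case (const c)
  then show ?case by (simp only: sf_op_var_mult sf_op_const sf_pd_mult sf_pd_const) (simp add: algebra_simps)
next
  case (var t j S)
  have "sf_op (var s i * (var t j * S)) f = sf_op (var s i * S) (f(t := sf_pd j (f t)))" for s
    by (simp only: mult.left_commute[of "var s i"]) (simp only: sf_op_var_mult[of t j])
  then show ?case by (simp add: sf_op_var_mult[of t j] var del: fun_upd_apply)
next
  case (add S T)
  then show ?case by (simp add: sf_op_add sf_pd_add distrib_left)
qed

section \<open>Lie derivatives and equivariance\<close>

lemma UNIV_slot: "(UNIV :: slot set) = {Xi, Eta, Zeta}"
  by (auto intro: slot.exhaust)

instance slot :: finite
  by standard (simp add: UNIV_slot)

lemma sum_slot: "(\<Sum>s\<in>UNIV. F s) = F Xi + F Eta + F Zeta" for F :: "slot \<Rightarrow> 'a::comm_monoid_add"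
  by (simp add: UNIV_slot add.assoc)

lemma sf_pd_op_sum: "sf_pd i (sf_op S f) = (\<Sum>s\<in>UNIV. sf_op (var s i * S) f)"
  by (simp add: sf_pd_op sum_slot)

lemma sf_op_slot_zero [simp]: "sf_op S (f(s := 0)) = 0"
  using sf_op_slot_const[of S f s 0 0] by (simp add: sf_const_simps del: fun_upd_apply)

lemma sf_op_slot_uminus: "sf_op S (f(s := - F)) = - sf_op S (f(s := F))"
  using sf_op_slot_const[of S f s "-1" F] by (simp add: sf_const_simps del: fun_upd_apply)

lemma sf_op_slot_diff: "sf_op S (f(s := F - G)) = sf_op S (f(s := F)) - sf_op S (f(s := G))"
  using sf_op_slot_add[of S f s F "- G"] sf_op_slot_uminus[of S f s G] by (simp del: fun_upd_apply)

lemma sf_op_slot_sum: "sf_op S (f(s := \<Sum>i\<in>I. F i)) = (\<Sum>i\<in>I. sf_op S (f(s := F i)))"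
  by (induction I rule: infinite_finite_induct) (auto simp: sf_op_slot_add simp del: fun_upd_apply)

definition directional :: "('n \<Rightarrow> 'n sfun) \<Rightarrow> 'n::finite sfun \<Rightarrow> 'n sfun" where
  "directional X F = (\<Sum>i\<in>UNIV. X i * sf_pd i F)"

definition sf_divergence :: "('n \<Rightarrow> 'n::finite sfun) \<Rightarrow> 'n sfun" where
  "sf_divergence X = (\<Sum>i\<in>UNIV. sf_pd i (X i))"

definition sf_lie :: "real \<Rightarrow> ('n \<Rightarrow> 'n sfun) \<Rightarrow> 'n::finite sfun \<Rightarrow> 'n sfun" where
  "sf_lie w X F = directional X F + sf_const w * sf_divergence X * F"

definition sf_bracket :: "('n \<Rightarrow> 'n sfun) \<Rightarrow> ('n \<Rightarrow> 'n sfun) \<Rightarrow> 'n \<Rightarrow> 'n::finite sfun" where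
  "sf_bracket X Y j = directional X (Y j) - directional Y (X j)"

lemma directional_derivation: "derivation (directional X)"
  unfolding derivation_def directional_def
  by (auto simp: sf_pd_add sf_pd_mult sum.distrib sum_distrib_left sum_distrib_right distrib_left mult_ac)

lemmas directional_add = derivation_add[OF directional_derivation]
  and directional_mult = derivation_mult[OF directional_derivation]
  and directional_sum = derivation_sum[OF directional_derivation]

lemma directional_const [simp]: "directional X (sf_const c) = 0"
  by (simp add: directional_def)

lemma directional_bracket: "directional (sf_bracket X Y) F = directional X (directional Y F) - directional Y (directional X F)"
proof -
  have comp: "directional X (directional Y F) = (\<Sum>j\<in>UNIV. directional X (Y j) * sf_pd j F)
      + (\<Sum>j\<in>UNIV. \<Sum>i\<in>UNIV. Y j * X i * sf_pd i (sf_pd j F))" for X Y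
    unfolding directional_def[of Y] directional_sum directional_mult
    by (simp add: directional_def sum.distrib sum_distrib_left mult.assoc)
  have "(\<Sum>j\<in>UNIV. \<Sum>i\<in>UNIV. Y j * X i * sf_pd i (sf_pd j F))
      = (\<Sum>j\<in>UNIV. \<Sum>i\<in>UNIV. X j * Y i * sf_pd i (sf_pd j F))"
    by (subst sum.swap) (simp add: sf_pd_commute mult.commute)
  then show ?thesis
    by (simp add: comp[of X Y] comp[of Y X] directional_def[of "sf_bracket X Y"] sf_bracket_def left_diff_distrib sum_subtractf)
qed

lemma sf_divergence_bracket: "sf_divergence (sf_bracket X Y) = directional X (sf_divergence Y) - directional Y (sf_divergence X)"
proof -
  have comp: "(\<Sum>j\<in>UNIV. sf_pd j (directional X (Y j))) = (\<Sum>j\<in>UNIV. \<Sum>i\<in>UNIV. sf_pd j (X i) * sf_pd i (Y j)) + directional X (sf_divergence Y)"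
    for X Y :: "'a \<Rightarrow> 'a sfun"
  proof -
    have "(\<Sum>j\<in>UNIV. sf_pd j (directional X (Y j))) = (\<Sum>j\<in>UNIV. \<Sum>i\<in>UNIV. sf_pd j (X i) * sf_pd i (Y j))
        + (\<Sum>j\<in>UNIV. \<Sum>i\<in>UNIV. X i * sf_pd j (sf_pd i (Y j)))"
      by (simp add: directional_def sf_pd_sum sf_pd_mult sum.distrib)
    also have "(\<Sum>j\<in>UNIV. \<Sum>i\<in>UNIV. X i * sf_pd j (sf_pd i (Y j))) = (\<Sum>i\<in>UNIV. \<Sum>j\<in>UNIV. X i * sf_pd i (sf_pd j (Y j)))"
      by (subst sum.swap) (intro sum.cong refl arg_cong2[where f = "(*)"] sf_pd_commute)
    also have "\<dots> = directional X (sf_divergence Y)"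
      by (simp add: directional_def sf_divergence_def sf_pd_sum sum_distrib_left)
    finally show ?thesis .
  qed
  have "(\<Sum>j\<in>UNIV. \<Sum>i\<in>UNIV. sf_pd j (X i) * sf_pd i (Y j)) = (\<Sum>j\<in>UNIV. \<Sum>i\<in>UNIV. sf_pd j (Y i) * sf_pd i (X j))"
    by (subst sum.swap) (simp add: mult.commute)
  then show ?thesis
    by (simp add: sf_divergence_def[of "sf_bracket X Y"] sf_bracket_def sf_pd_diff sum_subtractf comp)
qed

text \<open>The Lie derivative of densities represents the bracket because the divergence is a cocycle
(\<open>sf_divergence_bracket\<close>): its value on a bracket is the directional derivative of one
divergence minus that of the other.\<close>

lemma sf_lie_bracket: "sf_lie w (sf_bracket X Y) F = sf_lie w X (sf_lie w Y F) - sf_lie w Y (sf_lie w X F)"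
  by (simp add: sf_lie_def directional_bracket sf_divergence_bracket directional_add directional_mult algebra_simps)

lemma sf_lie_add: "sf_lie w X (F + G) = sf_lie w X F + sf_lie w X G"
  by (simp add: sf_lie_def directional_add algebra_simps)

lemma sf_lie_field_add: "sf_lie w (\<lambda>i. X i + Y i) F = sf_lie w X F + sf_lie w Y F"
  by (simp add: sf_lie_def directional_def sf_divergence_def sf_pd_add sum.distrib algebra_simps)

lemma sf_lie_field_scale: "sf_lie w (\<lambda>i. sf_const c * X i) F = sf_const c * sf_lie w X F"
  by (simp add: sf_lie_def directional_def sf_divergence_def sf_pd_const_mult sum_distrib_left algebra_simps)

definition equivariant ::
    "(slot \<Rightarrow> real) \<Rightarrow> real \<Rightarrow> 'n::finite symbol \<Rightarrow> ('n \<Rightarrow> 'n sfun) \<Rightarrow> bool" where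
  "equivariant w m S X \<longleftrightarrow> (\<forall>f. sf_lie m X (sf_op S f) = (\<Sum>s\<in>UNIV. sf_op S (f(s := sf_lie (w s) X (f s)))))"

lemma equivariant_add:
  "equivariant w m S X \<Longrightarrow> equivariant w m S Y \<Longrightarrow> equivariant w m S (\<lambda>i. X i + Y i)"
  by (simp add: equivariant_def sf_lie_field_add sf_op_slot_add sum.distrib)

lemma equivariant_scale:
  "equivariant w m S X \<Longrightarrow> equivariant w m S (\<lambda>i. sf_const c * X i)"
  by (simp add: equivariant_def sf_lie_field_scale sf_op_slot_const sum_distrib_left)

text \<open>Both sides of the equivariance condition represent brackets: the mixed terms, in which the two
fields act on different slots, are symmetric in the two fields and cancel.\<close>

lemma equivariant_bracket:
  assumes "equivariant w m S X" "equivariant w m S Y"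
  shows "equivariant w m S (sf_bracket X Y)"
proof -
  have X: "sf_lie m X (sf_op S f) = (\<Sum>s\<in>UNIV. sf_op S (f(s := sf_lie (w s) X (f s))))" for f
    using assms(1) by (simp add: equivariant_def)
  have Y: "sf_lie m Y (sf_op S f) = (\<Sum>s\<in>UNIV. sf_op S (f(s := sf_lie (w s) Y (f s))))" for f
    using assms(2) by (simp add: equivariant_def)
  show ?thesis
    unfolding equivariant_def sf_lie_bracket X Y sum_slot sf_lie_add sf_op_slot_diff
    by (simp del: fun_upd_apply add: fun_upd_same fun_upd_other
        fun_upd_twist[of Xi Eta] fun_upd_twist[of Xi Zeta] fun_upd_twist[of Eta Zeta])
qed

definition eps :: "'n set \<Rightarrow> 'n \<Rightarrow> real" where
  "eps Pos i = (if i \<in> Pos then 1 else - 1)"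

lemma eps_square [simp]: "eps Pos i * eps Pos i = 1"
  by (simp add: eps_def)

text \<open>The Kronecker symbol in an arbitrary ring; stating it as a factor lets sums over coordinates be
contracted by rewriting.\<close>

definition delta :: "'b \<Rightarrow> 'b \<Rightarrow> 'a::comm_ring_1" where "delta i j = (if i = j then 1 else 0)"

lemma delta_sum [simp]:
  fixes F G :: "'b::finite \<Rightarrow> 'a::comm_ring_1"
  shows "(\<Sum>j\<in>UNIV. delta i j * F j) = F i" "(\<Sum>j\<in>UNIV. delta j i * F j) = F i"
    "(\<Sum>j\<in>UNIV. F j * delta i j) = F i" "(\<Sum>j\<in>UNIV. F j * delta j i) = F i"
    "(\<Sum>j\<in>UNIV. F j * (delta i j * G j)) = F i * G i" "(\<Sum>j\<in>UNIV. F j * (delta j i * G j)) = F i * G i"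
proof -
  have *: "(\<Sum>j\<in>UNIV. H j) = H i" if "\<And>j. j \<noteq> i \<Longrightarrow> H j = 0" for H :: "'b \<Rightarrow> 'a"
    by (subst sum.remove[of _ i]) (auto simp: that)
  show "(\<Sum>j\<in>UNIV. delta i j * F j) = F i" "(\<Sum>j\<in>UNIV. delta j i * F j) = F i"
    "(\<Sum>j\<in>UNIV. F j * delta i j) = F i" "(\<Sum>j\<in>UNIV. F j * delta j i) = F i"
    "(\<Sum>j\<in>UNIV. F j * (delta i j * G j)) = F i * G i" "(\<Sum>j\<in>UNIV. F j * (delta j i * G j)) = F i * G i"
    by (subst *; simp add: delta_def)+
qed

lemma lower_nth: "lower Pos x $ i = eps Pos i * x $ i"
proof -
  have "flat_metric Pos $ i $ j = delta i j * eps Pos j" for j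
    by (simp add: flat_metric_def delta_def eps_def)
  then show ?thesis by (simp add: lower_def matrix_vector_mult_def mult.assoc)
qed

lemma sf_const_numeral [simp]: "sf_const (numeral k) = numeral k"
  by (induction k) (simp_all only: sf_const_simps numeral.simps)

definition sf_translation :: "'n \<Rightarrow> 'n \<Rightarrow> 'n::finite sfun" where
  "sf_translation i k = delta k i"

definition sf_rotation :: "'n set \<Rightarrow> 'n \<Rightarrow> 'n \<Rightarrow> 'n \<Rightarrow> 'n::finite sfun" where
  "sf_rotation Pos i j k = sf_const (eps Pos i) * sf_coord i * delta k j - sf_const (eps Pos j) * sf_coord j * delta k i"

definition sf_inversion :: "'n set \<Rightarrow> 'n \<Rightarrow> 'n \<Rightarrow> 'n::finite sfun" where
  "sf_inversion Pos i k = (\<Sum>j\<in>UNIV. sf_const (eps Pos j) * sf_coord j * sf_coord j) * delta k i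
     - 2 * sf_const (eps Pos i) * sf_coord i * sf_coord k"

lemma sf_numeral [simp]: "sf_apply (numeral k) x = numeral k"
  by (simp flip: sf_const_numeral)

lemma sf_delta [simp]: "sf_apply (delta i j) x = delta i j"
  by (simp add: delta_def)

lemma sf_pd_numeral [simp]: "sf_pd i 1 = 0" "sf_pd i 0 = 0" "sf_pd i (numeral k) = 0"
  using sf_pd_const[of i 1] sf_pd_const[of i 0] sf_pd_const[of i "numeral k"] by (simp_all add: sf_const_simps)

lemma sf_pd_delta [simp]: "sf_pd i (delta j k) = 0"
  by (simp add: delta_def)

lemma sf_pd_coord_delta: "sf_pd i (sf_coord j) = delta i j"
  by (simp add: sf_pd_coord delta_def sf_const_simps)

lemma sf_lie_translation: "sf_lie w (sf_translation i) F = sf_pd i F"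
  by (simp add: sf_lie_def directional_def sf_divergence_def sf_translation_def)

lemma sf_lie_rotation: "sf_lie w (sf_rotation Pos i j) F
    = sf_const (eps Pos i) * (sf_coord i * sf_pd j F) - sf_const (eps Pos j) * (sf_coord j * sf_pd i F)"
proof -
  have "sf_divergence (sf_rotation Pos i j) = sf_const (eps Pos i) * delta i j - sf_const (eps Pos j) * delta j i"
    by (simp add: sf_divergence_def sf_rotation_def sf_pd_diff sf_pd_mult sf_pd_coord_delta sum_subtractf mult.assoc
        sum_distrib_left[symmetric])
  then have "sf_divergence (sf_rotation Pos i j) = 0" by (simp add: delta_def)
  moreover have "directional (sf_rotation Pos i j) F
      = sf_const (eps Pos i) * (sf_coord i * sf_pd j F) - sf_const (eps Pos j) * (sf_coord j * sf_pd i F)"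
    by (simp add: directional_def sf_rotation_def left_diff_distrib sum_subtractf mult.assoc
        sum_distrib_left[symmetric])
  ultimately show ?thesis by (simp add: sf_lie_def)
qed

lemma of_nat_const: "of_nat k = sf_const (real k)"
  by (induction k) (simp_all add: sf_const_simps)

lemma sf_lie_euler: "sf_lie w (sf_coord :: 'n \<Rightarrow> 'n::finite sfun) F
    = (\<Sum>j\<in>UNIV. sf_coord j * sf_pd j F) + sf_const (w * real CARD('n)) * F"
proof -
  have "sf_divergence (sf_coord :: 'n \<Rightarrow> 'n sfun) = sf_const (real CARD('n))"
    by (simp add: sf_divergence_def sf_pd_coord sf_const_simps of_nat_const)
  then show ?thesis by (simp add: sf_lie_def directional_def sf_const_simps)
qed

lemma sf_lie_inversion: "sf_lie w (sf_inversion Pos i) (F :: 'n::finite sfun)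
    = (\<Sum>j\<in>UNIV. sf_const (eps Pos j) * (sf_coord j * (sf_coord j * sf_pd i F)))
      - 2 * sf_const (eps Pos i) * (\<Sum>j\<in>UNIV. sf_coord i * (sf_coord j * sf_pd j F))
      - 2 * sf_const (eps Pos i) * sf_const (w * real CARD('n)) * (sf_coord i * F)"
proof -
  let ?Q = "\<Sum>j\<in>UNIV. sf_const (eps Pos j) * sf_coord j * sf_coord j :: 'n sfun"
  have Q: "sf_pd i ?Q = 2 * sf_const (eps Pos i) * sf_coord i"
  proof -
    have "sf_pd i (sf_const (eps Pos j) * sf_coord j * sf_coord j) = 2 * sf_const (eps Pos j) * sf_coord j * delta i j" for j
      by (simp add: sf_pd_mult sf_pd_coord_delta algebra_simps)
    then show ?thesis by (simp add: sf_pd_sum)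
  qed
  have "sf_pd k (2 * sf_const (eps Pos i) * sf_coord i * sf_coord k)
      = 2 * sf_const (eps Pos i) * (delta k i * sf_coord k) + 2 * sf_const (eps Pos i) * sf_coord i" for k
    by (simp add: sf_pd_mult sf_pd_coord_delta algebra_simps) (simp add: delta_def)
  then have "sf_divergence (sf_inversion Pos i)
      = sf_pd i ?Q - (2 * sf_const (eps Pos i) * sf_coord i + of_nat CARD('n) * (2 * sf_const (eps Pos i) * sf_coord i))"
    by (simp add: sf_divergence_def sf_inversion_def sf_pd_diff sum_subtractf sf_pd_mult[of _ ?Q] sum.distrib
        sum_distrib_left[symmetric])
  then have "sf_divergence (sf_inversion Pos i) = - 2 * sf_const (eps Pos i) * sf_const (real CARD('n)) * sf_coord i"
    unfolding Q by (simp add: of_nat_const)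
  moreover have "directional (sf_inversion Pos i) F = ?Q * sf_pd i F - 2 * sf_const (eps Pos i) * (\<Sum>j\<in>UNIV. sf_coord i * (sf_coord j * sf_pd j F))"
    by (simp add: directional_def sf_inversion_def left_diff_distrib sum_subtractf sum_distrib_left mult.assoc)
  ultimately show ?thesis
    by (simp add: sf_lie_def sf_const_simps sum_distrib_left sum_distrib_right mult_ac)
qed

text \<open>The four operators on symbols that record the defect of equivariance. For a slot \<open>s\<close>,
\<open>euler_sym\<close> is the degree operator, \<open>box_sym\<close> the Laplacian of the metric,
\<open>rot_sym\<close> an infinitesimal rotation, and \<open>inv_sym\<close> the generator of
special conformal transformations in momentum space: what an inversion leaves behind in degree
zero of the coordinates.\<close>

definition euler_sym :: "slot \<Rightarrow> 'n::finite symbol \<Rightarrow> 'n symbol" where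
  "euler_sym s S = (\<Sum>j\<in>UNIV. var s j * der s j S)"

definition box_sym :: "'n set \<Rightarrow> slot \<Rightarrow> 'n::finite symbol \<Rightarrow> 'n symbol" where
  "box_sym Pos s S = (\<Sum>j\<in>UNIV. const (eps Pos j) * der s j (der s j S))"

definition rot_sym :: "'n set \<Rightarrow> 'n \<Rightarrow> 'n \<Rightarrow> slot \<Rightarrow> 'n::finite symbol \<Rightarrow> 'n symbol" where
  "rot_sym Pos i j s S = const (eps Pos i) * (var s j * der s i S) - const (eps Pos j) * (var s i * der s j S)"

definition inv_sym :: "'n set \<Rightarrow> real \<Rightarrow> 'n \<Rightarrow> slot \<Rightarrow> 'n::finite symbol \<Rightarrow> 'n symbol" where
  "inv_sym Pos w i s S = var s i * box_sym Pos s S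
     - 2 * const (eps Pos i) * (euler_sym s (der s i S) + const (w * real CARD('n)) * der s i S)"

lemma sf_op_slot_pd: "sf_op S (f(s := sf_pd i (f s))) = sf_op (var s i * S) f"
  by (simp add: sf_op_var_mult)

lemma sf_op_slot_coord_pd:
  "sf_op S (f(s := sf_coord i * sf_pd j (f s))) = sf_coord i * sf_op (var s j * S) f + sf_op (var s j * der s i S) f"
  by (simp add: sf_op_slot_coord sf_op_slot_pd del: fun_upd_apply)

lemma sf_op_slot_coord_coord_pd:
  "sf_op S (f(s := sf_coord i * (sf_coord k * sf_pd j (f s)))) = sf_coord i * (sf_coord k * sf_op (var s j * S) f)
     + sf_coord i * sf_op (var s j * der s k S) f + sf_coord k * sf_op (var s j * der s i S) f
     + sf_op (var s j * der s k (der s i S)) f"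
  by (simp add: sf_op_slot_coord[of S f s i "sf_coord k * _"] sf_op_slot_coord_pd distrib_left del: fun_upd_apply)

lemma equivariant_translation: "equivariant w m S (sf_translation i)"
  by (simp add: equivariant_def sf_lie_translation sf_pd_op_sum sf_op_slot_pd del: fun_upd_apply)

lemma equivariant_rotation:
  assumes "(\<Sum>s\<in>UNIV. rot_sym Pos i j s S) = 0"
  shows "equivariant w m S (sf_rotation Pos i j)"
  unfolding equivariant_def
proof
  fix f
  have "sf_op S (f(s := sf_lie (w s) (sf_rotation Pos i j) (f s)))
      = sf_const (eps Pos i) * (sf_coord i * sf_op (var s j * S) f) - sf_const (eps Pos j) * (sf_coord j * sf_op (var s i * S) f)
        + sf_op (rot_sym Pos i j s S) f" for s
    by (simp add: sf_lie_rotation sf_op_slot_diff sf_op_slot_const sf_op_slot_coord_pd distrib_left rot_sym_def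
        sf_op_diff sf_op_const_mult del: fun_upd_apply)
  then have "(\<Sum>s\<in>UNIV. sf_op S (f(s := sf_lie (w s) (sf_rotation Pos i j) (f s))))
      = sf_const (eps Pos i) * (sf_coord i * sf_pd j (sf_op S f)) - sf_const (eps Pos j) * (sf_coord j * sf_pd i (sf_op S f))
        + sf_op (\<Sum>s\<in>UNIV. rot_sym Pos i j s S) f"
    by (simp add: sf_pd_op_sum sum.distrib sum_subtractf sum_distrib_left sf_op_sum del: fun_upd_apply)
  with assms show "sf_lie m (sf_rotation Pos i j) (sf_op S f)
      = (\<Sum>s\<in>UNIV. sf_op S (f(s := sf_lie (w s) (sf_rotation Pos i j) (f s))))"
    by (simp add: sf_lie_rotation)
qed

lemma equivariant_euler:
  fixes S :: "'n::finite symbol"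
  assumes "(\<Sum>s\<in>UNIV. euler_sym s S) = const c * S"
    and m: "m * real CARD('n) = (\<Sum>s\<in>UNIV. w s) * real CARD('n) + c"
  shows "equivariant w m S sf_coord"
  unfolding equivariant_def
proof
  fix f
  have "(\<Sum>s\<in>UNIV. sf_op S (f(s := sf_lie (w s) sf_coord (f s))))
      = (\<Sum>j\<in>UNIV. sf_coord j * sf_pd j (sf_op S f)) + sf_op (\<Sum>s\<in>UNIV. euler_sym s S) f
        + (\<Sum>s\<in>UNIV. sf_const (w s * real CARD('n)) * sf_op S f)"
    by (simp add: sf_lie_euler sf_op_slot_add sf_op_slot_sum sf_op_slot_const sf_op_slot_coord_pd sf_pd_op_sum sum.distrib
        sum_distrib_left sf_op_sum euler_sym_def sum.swap[of _ _ "UNIV :: 'n set"] del: fun_upd_apply)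
  also have "\<dots> = (\<Sum>j\<in>UNIV. sf_coord j * sf_pd j (sf_op S f)) + sf_const (m * real CARD('n)) * sf_op S f"
    by (simp add: assms(1) m sum_slot sf_op_const_mult sf_const_simps distrib_left distrib_right)
  finally show "sf_lie m sf_coord (sf_op S f) = (\<Sum>s\<in>UNIV. sf_op S (f(s := sf_lie (w s) sf_coord (f s))))"
    by (simp add: sf_lie_euler)
qed

text \<open>An inversion is quadratic in the coordinates, so moving it through the operator by the Heisenberg
relation produces terms of degree two, one and zero in the coordinates. Degree two repeats the
inversion on the outside; degree one consists of an infinitesimal rotation and of the degree
operator together with the weight; degree zero is \<open>inv_sym\<close>.\<close>

lemma sf_op_slot_inversion:
  fixes S :: "'n::finite symbol"
  shows "sf_op S (f(s := sf_lie w (sf_inversion Pos i) (f s)))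
    = (\<Sum>j\<in>UNIV. sf_const (eps Pos j) * (sf_coord j * (sf_coord j * sf_op (var s i * S) f)))
      - 2 * sf_const (eps Pos i) * (\<Sum>j\<in>UNIV. sf_coord i * (sf_coord j * sf_op (var s j * S) f))
      - 2 * (\<Sum>j\<in>UNIV. sf_coord j * sf_op (rot_sym Pos i j s S) f)
      - 2 * sf_const (eps Pos i) * (sf_coord i * (sf_op (euler_sym s S) f + sf_const (w * real CARD('n)) * sf_op S f))
      + sf_op (inv_sym Pos w i s S) f"
proof -
  have "sf_op S (f(s := sf_lie w (sf_inversion Pos i) (f s)))
    = (\<Sum>j\<in>UNIV. sf_const (eps Pos j) * sf_op S (f(s := sf_coord j * (sf_coord j * sf_pd i (f s)))))
      - 2 * sf_const (eps Pos i) * (\<Sum>j\<in>UNIV. sf_op S (f(s := sf_coord i * (sf_coord j * sf_pd j (f s)))))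
      - 2 * sf_const (eps Pos i) * sf_const (w * real CARD('n)) * sf_op S (f(s := sf_coord i * f s))"
  proof -
    have two: "sf_op S (f(s := 2 * sf_const c * F)) = 2 * sf_const c * sf_op S (f(s := F))"
      "sf_op S (f(s := 2 * sf_const c * sf_const d * F)) = 2 * sf_const c * sf_const d * sf_op S (f(s := F))" for c d F
      using sf_op_slot_const[of S f s "2 * c" F] sf_op_slot_const[of S f s "2 * c * d" F]
      by (simp_all add: sf_const_simps del: fun_upd_apply)
    show ?thesis
      by (simp only: sf_lie_inversion sf_op_slot_diff two sf_op_slot_sum sf_op_slot_const)
  qed
  also have "(\<Sum>j\<in>UNIV. sf_const (eps Pos j) * sf_op S (f(s := sf_coord j * (sf_coord j * sf_pd i (f s)))))
    = (\<Sum>j\<in>UNIV. sf_const (eps Pos j) * (sf_coord j * (sf_coord j * sf_op (var s i * S) f)))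
      + 2 * (\<Sum>j\<in>UNIV. sf_coord j * (sf_const (eps Pos j) * sf_op (var s i * der s j S) f))
      + sf_op (var s i * box_sym Pos s S) f"
  proof -
    have "sf_op (var s i * box_sym Pos s S) f = (\<Sum>j\<in>UNIV. sf_const (eps Pos j) * sf_op (var s i * der s j (der s j S)) f)"
      by (simp add: box_sym_def sum_distrib_left sf_op_sum sf_op_const_mult[symmetric] mult.left_commute)
    then show ?thesis
      by (simp only: sf_op_slot_coord_coord_pd)
        (simp add: sum_distrib_left sum.distrib[symmetric] algebra_simps)
  qed
  also have "(\<Sum>j\<in>UNIV. sf_op S (f(s := sf_coord i * (sf_coord j * sf_pd j (f s)))))
    = (\<Sum>j\<in>UNIV. sf_coord i * (sf_coord j * sf_op (var s j * S) f)) + sf_coord i * sf_op (euler_sym s S) f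
      + (\<Sum>j\<in>UNIV. sf_coord j * sf_op (var s j * der s i S) f) + sf_op (euler_sym s (der s i S)) f"
  proof -
    have "der s j (der s i S) = der s i (der s j S)" for j
      by (induction S rule: symbol_induct) (auto simp: der_var_mult der_add)
    then show ?thesis
      by (simp only: sf_op_slot_coord_coord_pd)
        (simp add: euler_sym_def sf_op_sum sum_distrib_left sum.distrib)
  qed
  also have "sf_op S (f(s := sf_coord i * f s)) = sf_coord i * sf_op S f + sf_op (der s i S) f"
    using sf_op_slot_coord[of S f s i "f s"] by (simp del: fun_upd_apply)
  also note main = calculation
  have rot: "(\<Sum>j\<in>UNIV. sf_coord j * sf_op (rot_sym Pos i j s S) f)
     = sf_const (eps Pos i) * (\<Sum>j\<in>UNIV. sf_coord j * sf_op (var s j * der s i S) f)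
       - (\<Sum>j\<in>UNIV. sf_coord j * (sf_const (eps Pos j) * sf_op (var s i * der s j S) f))"
    by (simp add: rot_sym_def sf_op_diff sf_op_const_mult right_diff_distrib sum_subtractf sum_distrib_left
        mult.left_commute[of "sf_coord _"])
  have inv: "sf_op (inv_sym Pos w i s S) f = sf_op (var s i * box_sym Pos s S) f
      - 2 * sf_const (eps Pos i) * (sf_op (euler_sym s (der s i S)) f + sf_const (w * real CARD('n)) * sf_op (der s i S) f)"
  proof -
    have "sf_op (2 * const c * T) f = 2 * sf_const c * sf_op T f" for c T
      using sf_op_const_mult[of "2 * c" T f] by (simp add: const_simps sf_const_simps const_numeral)
    then show ?thesis
      by (simp add: inv_sym_def sf_op_diff sf_op_add sf_op_const_mult)
  qed
  show ?thesis unfolding main rot inv by (simp add: algebra_simps)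
qed

text \<open>Summed over the slots, the degree two terms add up to the Lie derivative of the result by the
Leibniz rule. The rotation terms vanish, and the degree operator contributes exactly the shift of
the weight from the sum of the three weights to \<open>m\<close>. The condition left over is the
vanishing of the terms of degree zero.\<close>

lemma equivariant_inversion:
  fixes S :: "'n::finite symbol"
  assumes rot: "\<And>j. (\<Sum>s\<in>UNIV. rot_sym Pos i j s S) = 0"
    and eul: "(\<Sum>s\<in>UNIV. euler_sym s S) = const c * S"
    and m: "m * real CARD('n) = (\<Sum>s\<in>UNIV. w s) * real CARD('n) + c"
    and inv: "(\<Sum>s\<in>UNIV. inv_sym Pos (w s) i s S) = 0"
  shows "equivariant w m S (sf_inversion Pos i)"
  unfolding equivariant_def
proof
  fix f
  have 1: "(\<Sum>s\<in>UNIV. \<Sum>j\<in>UNIV. sf_const (eps Pos j) * (sf_coord j * (sf_coord j * sf_op (var s i * S) f)))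
      = (\<Sum>j\<in>UNIV. sf_const (eps Pos j) * (sf_coord j * (sf_coord j * sf_pd i (sf_op S f))))"
    by (subst sum.swap) (simp add: sf_pd_op_sum sum_distrib_left)
  have 2: "(\<Sum>s\<in>UNIV. \<Sum>j\<in>UNIV. sf_coord i * (sf_coord j * sf_op (var s j * S) f))
      = (\<Sum>j\<in>UNIV. sf_coord i * (sf_coord j * sf_pd j (sf_op S f)))"
    by (subst sum.swap) (simp add: sf_pd_op_sum sum_distrib_left)
  have 3: "(\<Sum>s\<in>UNIV. \<Sum>j\<in>UNIV. sf_coord j * sf_op (rot_sym Pos i j s S) f) = 0"
  proof -
    have "(\<Sum>s\<in>UNIV. \<Sum>j\<in>UNIV. sf_coord j * sf_op (rot_sym Pos i j s S) f)
        = (\<Sum>j\<in>UNIV. sf_coord j * sf_op (\<Sum>s\<in>UNIV. rot_sym Pos i j s S) f)"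
      by (subst sum.swap) (simp add: sf_op_sum sum_distrib_left)
    then show ?thesis by (simp add: rot)
  qed
  have 4: "(\<Sum>s\<in>UNIV. sf_coord i * (sf_op (euler_sym s S) f + sf_const (w s * real CARD('n)) * sf_op S f))
      = sf_const (m * real CARD('n)) * (sf_coord i * sf_op S f)"
  proof -
    have "(\<Sum>s\<in>UNIV. sf_coord i * (sf_op (euler_sym s S) f + sf_const (w s * real CARD('n)) * sf_op S f))
        = sf_coord i * (sf_op (\<Sum>s\<in>UNIV. euler_sym s S) f + (\<Sum>s\<in>UNIV. sf_const (w s * real CARD('n)) * sf_op S f))"
      by (simp add: sf_op_sum sum_distrib_left sum.distrib distrib_left)
    also have "\<dots> = sf_coord i * (sf_const c * sf_op S f + (\<Sum>s\<in>UNIV. sf_const (w s * real CARD('n)) * sf_op S f))"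
      by (simp only: eul sf_op_const_mult)
    finally show ?thesis
      by (simp add: m sum_slot sf_const_simps algebra_simps)
  qed
  have 5: "(\<Sum>s\<in>UNIV. sf_op (inv_sym Pos (w s) i s S) f) = 0"
    by (simp add: sf_op_sum[symmetric] inv)
  have "(\<Sum>s\<in>UNIV. sf_op S (f(s := sf_lie (w s) (sf_inversion Pos i) (f s))))
    = (\<Sum>j\<in>UNIV. sf_const (eps Pos j) * (sf_coord j * (sf_coord j * sf_pd i (sf_op S f))))
      - 2 * sf_const (eps Pos i) * (\<Sum>j\<in>UNIV. sf_coord i * (sf_coord j * sf_pd j (sf_op S f)))
      - 2 * sf_const (eps Pos i) * (sf_const (m * real CARD('n)) * (sf_coord i * sf_op S f))"
  proof -
    have "(\<Sum>s\<in>UNIV. 2 * sf_const (eps Pos i) * G s) = 2 * sf_const (eps Pos i) * (\<Sum>s\<in>UNIV. G s)"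
      "(\<Sum>s\<in>UNIV. 2 * G s) = 2 * (\<Sum>s\<in>UNIV. G s)" for G :: "slot \<Rightarrow> 'n sfun"
      by (simp_all only: sum_distrib_left)
    then show ?thesis
      by (simp only: sf_op_slot_inversion sum_subtractf sum.distrib 1 2 3 4 5) simp
  qed
  then show "sf_lie m (sf_inversion Pos i) (sf_op S f)
      = (\<Sum>s\<in>UNIV. sf_op S (f(s := sf_lie (w s) (sf_inversion Pos i) (f s))))"
    by (simp only: sf_lie_inversion mult.assoc)
qed

lemma lie_deriv_lie:
  assumes "\<And>x i. X x $ i = sf_apply (Xs i) x"
  shows "lie_deriv w X (sf_apply F) = sf_apply (sf_lie w Xs F)"
proof -
  have "(\<lambda>y. X y $ i) = sf_apply (Xs i)" for i by (simp add: assms fun_eq_iff)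
  then show ?thesis
    by (intro ext) (simp add: lie_deriv_def divergence_def sf_lie_def directional_def sf_divergence_def assms)
qed

text \<open>The generators suffice, since equivariance passes to linear combinations and brackets. The
induction carries along that the components of the fields are smooth, because otherwise the iterated
Lie derivatives that compute a bracket would leave the smooth functions.\<close>

lemma conf_algebra_equivariant:
  fixes S :: "'n::finite symbol"
  assumes X: "X \<in> conf_algebra Pos"
    and rot: "\<And>i j. (\<Sum>s\<in>UNIV. rot_sym Pos i j s S) = 0"
    and eul: "(\<Sum>s\<in>UNIV. euler_sym s S) = const c * S"
    and m: "m * real CARD('n) = (\<Sum>s\<in>UNIV. w s) * real CARD('n) + c"
    and inv: "\<And>i. (\<Sum>s\<in>UNIV. inv_sym Pos (w s) i s S) = 0"
  shows "\<exists>Xs. (\<forall>x i. X x $ i = sf_apply (Xs i) x) \<and> equivariant w m S Xs"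
  using X
proof (induction rule: conf_algebra.induct)
  case (translation i)
  have "\<forall>x k. vf_translation i x $ k = sf_apply (sf_translation i k) x"
    by (auto simp: vf_translation_def sf_translation_def delta_def axis_def)
  then show ?case using equivariant_translation by blast
next
  case (rotation i j)
  have "\<forall>x k. vf_rotation Pos i j x $ k = sf_apply (sf_rotation Pos i j k) x"
    by (auto simp: vf_rotation_def sf_rotation_def delta_def axis_def lower_nth)
  then show ?case using equivariant_rotation[OF rot] by blast
next
  case euler
  have "vf_euler x $ i = x $ i" for x :: "real^'n" and i
  proof -
    have "vf_euler x $ i = (\<Sum>j\<in>UNIV. x $ j * delta j i)"
      by (auto simp: vf_euler_def axis_def delta_def intro!: sum.cong)
    then show ?thesis by simp
  qed
  then show ?case
    using equivariant_euler[OF eul m] by (intro exI[of _ sf_coord]) simp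
next
  case (inversion i)
  have "vf_inversion Pos i x $ k = sf_apply (sf_inversion Pos i k) x" for x :: "real^'n" and k
  proof -
    have "vf_inversion Pos i x $ k = (\<Sum>j\<in>UNIV. eps Pos j * x $ j * x $ j) * delta k i
        - (\<Sum>j\<in>UNIV. 2 * (eps Pos i * x $ i) * x $ j * delta j k)"
      by (auto simp: vf_inversion_def axis_def delta_def lower_nth intro!: sum.cong)
    then show ?thesis by (simp add: sf_inversion_def)
  qed
  then show ?case
    using equivariant_inversion[OF rot eul m inv] by blast
next
  case (add X Y)
  then obtain Xs Ys where
    "\<forall>x i. X x $ i = sf_apply (Xs i) x" "equivariant w m S Xs"
    "\<forall>x i. Y x $ i = sf_apply (Ys i) x" "equivariant w m S Ys" by blast
  then show ?case by (intro exI[of _ "\<lambda>i. Xs i + Ys i"]) (simp add: equivariant_add)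
next
  case (scale X c)
  then obtain Xs where "\<forall>x i. X x $ i = sf_apply (Xs i) x" "equivariant w m S Xs" by blast
  then show ?case by (intro exI[of _ "\<lambda>i. sf_const c * Xs i"]) (simp add: equivariant_scale)
next
  case (brack X Y)
  then obtain Xs Ys where X: "\<And>x i. X x $ i = sf_apply (Xs i) x" "equivariant w m S Xs"
    and Y: "\<And>x i. Y x $ i = sf_apply (Ys i) x" "equivariant w m S Ys" by blast
  have "(\<lambda>y. X y $ i) = sf_apply (Xs i)" "(\<lambda>y. Y y $ i) = sf_apply (Ys i)" for i
    by (simp_all add: X Y fun_eq_iff)
  then have "bracket X Y x $ i = sf_apply (sf_bracket Xs Ys i) x" for x i
    by (simp add: bracket_def sf_bracket_def directional_def X(1) Y(1) sum_subtractf)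
  then show ?case using equivariant_bracket[OF X(2) Y(2)] by blast
qed

lemma invariant_op_symbol:
  fixes S :: "'n::finite symbol"
  assumes rot: "\<And>i j. (\<Sum>s\<in>UNIV. rot_sym Pos i j s S) = 0"
    and eul: "(\<Sum>s\<in>UNIV. euler_sym s S) = const c * S"
    and inv: "\<And>i. (\<Sum>s\<in>UNIV. inv_sym Pos (w s) i s S) = 0"
    and m: "m * real CARD('n) = (\<Sum>s\<in>UNIV. w s) * real CARD('n) + c"
  shows "invariant_op (conf_algebra Pos) (w Xi) (w Eta) (w Zeta) m (symbol_op S)"
  unfolding invariant_op_def
proof (intro ballI allI impI)
  fix X and u v z :: "real^'n \<Rightarrow> real" and x
  assume X: "X \<in> conf_algebra Pos" and sm: "smooth u" "smooth v" "smooth z"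
  obtain Xs where Xs: "\<And>x i. X x $ i = sf_apply (Xs i) x" and eq: "equivariant w m S Xs"
    using conf_algebra_equivariant[OF X rot eul m inv] by blast
  define f where "f = case_slot (sf_Abs u) (sf_Abs v) (sf_Abs z)"
  have f: "sf_apply (f Xi) = u" "sf_apply (f Eta) = v" "sf_apply (f Zeta) = z"
    using sm by (simp_all add: f_def sf_Abs_inverse)
  have lie: "lie_deriv w' X (sf_apply F) = sf_apply (sf_lie w' Xs F)" for w' F
    by (rule lie_deriv_lie) (rule Xs)
  have ops: "symbol_op S (sf_apply (f' Xi)) (sf_apply (f' Eta)) (sf_apply (f' Zeta)) = sf_apply (sf_op S f')"
    for f' by (rule symbol_op_op)
  have "lie_deriv m X (symbol_op S u v z) x = sf_apply (sf_lie m Xs (sf_op S f)) x"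
    unfolding f[symmetric] ops lie ..
  also have "\<dots> = (\<Sum>s\<in>UNIV. sf_apply (sf_op S (f(s := sf_lie (w s) Xs (f s)))) x)"
    using eq by (simp add: equivariant_def del: fun_upd_apply)
  also have "\<dots> = symbol_op S (lie_deriv (w Xi) X u) v z x + symbol_op S u (lie_deriv (w Eta) X v) z x
      + symbol_op S u v (lie_deriv (w Zeta) X z) x"
    unfolding sum_slot ops[symmetric] by (simp add: lie[symmetric] f)
  finally show "lie_deriv m X (symbol_op S u v z) x =
      symbol_op S (lie_deriv (w Xi) X u) v z x + symbol_op S u (lie_deriv (w Eta) X v) z x
      + symbol_op S u v (lie_deriv (w Zeta) X z) x" .
qed

section \<open>The inversions on invariant symbols\<close>

lemma flat_metric_nth: "flat_metric Pos $ i $ j = delta i j * eps Pos j"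
  by (simp add: flat_metric_def delta_def eps_def)

lemma flat_metric_square: "flat_metric Pos ** flat_metric Pos = mat 1"
  by (simp add: vec_eq_iff matrix_matrix_mult_def flat_metric_nth mult.assoc)
    (simp add: mat_def delta_def mult.left_commute)

lemma matrix_inv_flat_metric: "matrix_inv (flat_metric Pos) = flat_metric Pos"
proof -
  have "flat_metric Pos ** matrix_inv (flat_metric Pos) = mat 1"
    unfolding matrix_inv_def by (rule someI2[of _ "flat_metric Pos"]) (auto simp: flat_metric_square)
  then have "(flat_metric Pos ** flat_metric Pos) ** matrix_inv (flat_metric Pos) = flat_metric Pos"
    by (simp add: matrix_mul_assoc[symmetric])
  then show ?thesis by (simp add: flat_metric_square)
qed

lemma R2_eq:
  fixes Pos :: "'n::finite set"
  shows "R2 Pos s t = (\<Sum>i\<in>UNIV. const (eps Pos i) * (var s i * var t i))"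
proof -
  have "const (matrix_inv (flat_metric Pos) $ i $ j) = delta i j * (const (eps Pos j) :: 'n symbol)" for i j :: 'n
    by (simp add: matrix_inv_flat_metric flat_metric_nth delta_def const_simps)
  then show ?thesis by (simp add: R2_def mult.assoc)
qed

lemma R2_commute: "R2 Pos s t = R2 Pos t s"
  by (simp add: R2_eq mult.commute[of "var s _"])

lemma der_R2: "der s i (R2 Pos t u) = const (eps Pos i) * (delta s t * var u i + delta s u * var t i)"
proof -
  have "der s i (const c * (var t j * var u j)) = delta i j * (const c * (delta s t * var u j + delta s u * var t j))"
    for j c
    by (auto simp: der_const_mult der_var_mult der_var delta_def algebra_simps)
  then show ?thesis by (simp add: R2_eq der_sum)
qed

lemma const_int: "const (of_int k) = of_int k"
  by (simp add: const_def)

text \<open>Powers with integer exponents, zero when the exponent is negative. With this convention the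
derivative of a power and the index shifts of the recursion need no case distinction at zero.\<close>

definition zpower :: "'a::comm_ring_1 \<Rightarrow> int \<Rightarrow> 'a" where
  "zpower x k = (if k < 0 then 0 else x ^ nat k)"

lemma zpower_step: "k \<ge> 0 \<Longrightarrow> x * zpower x k = zpower x (k + 1)"
  by (simp add: zpower_def nat_add_distrib)

lemma zpower_int_step: "of_int k * (x * zpower x (k - 1)) = of_int k * zpower x k"
  using zpower_step[of "k - 1" x] by (cases "k = 0") (auto simp: zpower_def)

lemma derivation_zpower: "derivation d \<Longrightarrow> d (zpower x k) = of_int k * zpower x (k - 1) * d x"
proof -
  assume d: "derivation d"
  show ?thesis
  proof (cases "k \<le> 0")
    case True
    then show ?thesis using d by (auto simp: zpower_def derivation_zero derivation_one)
  next
    case False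
    then obtain m where "k = int (Suc m)" by (metis not_le zero_less_imp_eq_int less_imp_Suc_add add_0)
    then show ?thesis using d by (simp add: zpower_def derivation_power nat_add_distrib del: power_Suc)
  qed
qed

text \<open>A monomial in the six contractions, seen from the slot \<open>s\<close>: the exponents
\<open>a, b, c\<close> belong to the contractions that involve \<open>s\<close>. A computation in
the slot \<open>s\<close> done once then serves all three slots, through \<open>zmon_permute\<close>.\<close>

definition zmon :: "'n set \<Rightarrow> slot \<Rightarrow> slot \<Rightarrow> slot \<Rightarrow> int \<Rightarrow> int \<Rightarrow> int \<Rightarrow> int \<Rightarrow> int \<Rightarrow> int \<Rightarrow> 'n::finite symbol" where
  "zmon Pos s t u a b c d e f = zpower (R2 Pos s s) a * zpower (R2 Pos s t) b * zpower (R2 Pos s u) c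
     * zpower (R2 Pos t t) d * zpower (R2 Pos t u) e * zpower (R2 Pos u u) f"

lemma zmon_steps:
  "of_int a * (R2 Pos s s * zmon Pos s t u (a - 1) b c d e f) = of_int a * zmon Pos s t u a b c d e f"
  "of_int b * (R2 Pos s t * zmon Pos s t u a (b - 1) c d e f) = of_int b * zmon Pos s t u a b c d e f"
  "of_int c * (R2 Pos s u * zmon Pos s t u a b (c - 1) d e f) = of_int c * zmon Pos s t u a b c d e f"
  "d \<ge> 0 \<Longrightarrow> R2 Pos t t * zmon Pos s t u a b c d e f = zmon Pos s t u a b c (d + 1) e f"
  "e \<ge> 0 \<Longrightarrow> R2 Pos t u * zmon Pos s t u a b c d e f = zmon Pos s t u a b c d (e + 1) f"
  "f \<ge> 0 \<Longrightarrow> R2 Pos u u * zmon Pos s t u a b c d e f = zmon Pos s t u a b c d e (f + 1)"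
proof -
  have "of_int a * (R2 Pos s s * zmon Pos s t u (a - 1) b c d e f)
      = (of_int a * (R2 Pos s s * zpower (R2 Pos s s) (a - 1))) * zpower (R2 Pos s t) b * zpower (R2 Pos s u) c
     * zpower (R2 Pos t t) d * zpower (R2 Pos t u) e * zpower (R2 Pos u u) f"
    unfolding zmon_def by (simp only: mult_ac)
  then show "of_int a * (R2 Pos s s * zmon Pos s t u (a - 1) b c d e f) = of_int a * zmon Pos s t u a b c d e f"
    unfolding zpower_int_step zmon_def by (simp only: mult_ac)
  have "of_int b * (R2 Pos s t * zmon Pos s t u a (b - 1) c d e f)
      = (of_int b * (R2 Pos s t * zpower (R2 Pos s t) (b - 1))) * zpower (R2 Pos s s) a * zpower (R2 Pos s u) c
     * zpower (R2 Pos t t) d * zpower (R2 Pos t u) e * zpower (R2 Pos u u) f"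
    unfolding zmon_def by (simp only: mult_ac)
  then show "of_int b * (R2 Pos s t * zmon Pos s t u a (b - 1) c d e f) = of_int b * zmon Pos s t u a b c d e f"
    unfolding zpower_int_step zmon_def by (simp only: mult_ac)
  have "of_int c * (R2 Pos s u * zmon Pos s t u a b (c - 1) d e f)
      = (of_int c * (R2 Pos s u * zpower (R2 Pos s u) (c - 1))) * zpower (R2 Pos s s) a * zpower (R2 Pos s t) b
     * zpower (R2 Pos t t) d * zpower (R2 Pos t u) e * zpower (R2 Pos u u) f"
    unfolding zmon_def by (simp only: mult_ac)
  then show "of_int c * (R2 Pos s u * zmon Pos s t u a b (c - 1) d e f) = of_int c * zmon Pos s t u a b c d e f"
    unfolding zpower_int_step zmon_def by (simp only: mult_ac)
  show "R2 Pos t t * zmon Pos s t u a b c d e f = zmon Pos s t u a b c (d + 1) e f" if "d \<ge> 0"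
    unfolding zmon_def zpower_step[OF that, symmetric] by (simp only: mult_ac)
  show "R2 Pos t u * zmon Pos s t u a b c d e f = zmon Pos s t u a b c d (e + 1) f" if "e \<ge> 0"
    unfolding zmon_def zpower_step[OF that, symmetric] by (simp only: mult_ac)
  show "R2 Pos u u * zmon Pos s t u a b c d e f = zmon Pos s t u a b c d e (f + 1)" if "f \<ge> 0"
    unfolding zmon_def zpower_step[OF that, symmetric] by (simp only: mult_ac)
qed

lemma derivation_zmon:
  assumes "derivation T"
  shows "T (zmon Pos s t u a b c d e f) =
      of_int a * zmon Pos s t u (a - 1) b c d e f * T (R2 Pos s s)
    + of_int b * zmon Pos s t u a (b - 1) c d e f * T (R2 Pos s t)
    + of_int c * zmon Pos s t u a b (c - 1) d e f * T (R2 Pos s u)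
    + of_int d * zmon Pos s t u a b c (d - 1) e f * T (R2 Pos t t)
    + of_int e * zmon Pos s t u a b c d (e - 1) f * T (R2 Pos t u)
    + of_int f * zmon Pos s t u a b c d e (f - 1) * T (R2 Pos u u)"
  unfolding zmon_def
  by (simp only: derivation_mult[OF assms] derivation_zpower[OF assms] distrib_right distrib_left mult_ac add_ac)

text \<open>The derivative of a monomial with respect to \<open>(s, i)\<close>, up to the sign of the metric in
the direction \<open>i\<close>; see \<open>der_zmon\<close>.\<close>

definition zmon_gradient :: "'n set \<Rightarrow> slot \<Rightarrow> slot \<Rightarrow> slot \<Rightarrow> 'n \<Rightarrow> int \<Rightarrow> int \<Rightarrow> int \<Rightarrow> int \<Rightarrow> int \<Rightarrow> int \<Rightarrow> 'n::finite symbol" where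
  "zmon_gradient Pos s t u i a b c d e f = 2 * of_int a * (var s i * zmon Pos s t u (a - 1) b c d e f)
    + of_int b * (var t i * zmon Pos s t u a (b - 1) c d e f)
    + of_int c * (var u i * zmon Pos s t u a b (c - 1) d e f)"

lemma const_eps_square: "const (eps Pos i) * (const (eps Pos i) * S) = S" for S :: "'m symbol"
proof -
  have "const (eps Pos i) * const (eps Pos i) = (1 :: 'm symbol)"
    unfolding const_simps(4)[symmetric] by (simp add: const_simps)
  then show ?thesis by (simp add: mult.assoc[symmetric])
qed

lemma der_zmon:
  assumes "s \<noteq> t" "s \<noteq> u"
  shows "der s i (zmon Pos s t u a b c d e f) = const (eps Pos i) * zmon_gradient Pos s t u i a b c d e f"
  using assms
  by (simp add: derivation_zmon[OF der_derivation] der_R2 delta_def zmon_gradient_def algebra_simps)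

lemma contract_zmon:
  assumes "s \<noteq> t" "s \<noteq> u"
  shows "(\<Sum>j\<in>UNIV. var v j * der s j (zmon Pos s t u a b c d e f)) =
      2 * of_int a * (R2 Pos v s * zmon Pos s t u (a - 1) b c d e f)
    + of_int b * (R2 Pos v t * zmon Pos s t u a (b - 1) c d e f)
    + of_int c * (R2 Pos v u * zmon Pos s t u a b (c - 1) d e f)"
  by (simp add: der_zmon[OF assms] zmon_gradient_def R2_eq sum_distrib_left sum_distrib_right sum.distrib distrib_left
      distrib_right mult_ac)

lemma euler_zmon:
  assumes "s \<noteq> t" "s \<noteq> u"
  shows "euler_sym s (zmon Pos s t u a b c d e f) = of_int (2 * a + b + c) * zmon Pos s t u a b c d e f"
proof -
  have "euler_sym s (zmon Pos s t u a b c d e f)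
    = 2 * (of_int a * (R2 Pos s s * zmon Pos s t u (a - 1) b c d e f))
    + of_int b * (R2 Pos s t * zmon Pos s t u a (b - 1) c d e f)
    + of_int c * (R2 Pos s u * zmon Pos s t u a b (c - 1) d e f)"
    unfolding euler_sym_def contract_zmon[OF assms] by (simp only: mult.assoc)
  then show ?thesis unfolding zmon_steps by (simp add: algebra_simps)
qed

lemma euler_derivation: "derivation (euler_sym s)"
  unfolding derivation_def euler_sym_def
  by (auto simp: der_add der_mult sum.distrib sum_distrib_left sum_distrib_right distrib_left mult_ac)

lemmas euler_mult = derivation_mult[OF euler_derivation]
  and euler_add = derivation_add[OF euler_derivation]

lemma euler_const: "euler_sym s (const c) = 0"
  by (simp add: euler_sym_def)

lemma euler_of_int [simp]: "euler_sym s (of_int k) = 0" "euler_sym s (numeral m) = 0"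
  using euler_const[of s "of_int k"] euler_const[of s "numeral m"] by (simp_all add: const_int const_numeral)

lemma euler_var: "euler_sym s (var t i) = delta s t * var s i"
proof -
  have "euler_sym s (var t i) = (\<Sum>j\<in>UNIV. delta s t * (var s j * delta j i))"
    by (auto simp: euler_sym_def der_var delta_def intro!: sum.cong)
  then show ?thesis by (simp add: sum_distrib_left[symmetric])
qed

text \<open>The Laplacian contracts a gradient with a derivative. Each contraction of two covectors is again
one of the six basic ones, so the result is a combination of monomials.\<close>

lemma box_zmon:
  fixes Pos :: "'n::finite set"
  assumes "s \<noteq> t" "s \<noteq> u" and "d \<ge> 0" "e \<ge> 0" "f \<ge> 0"
  shows "box_sym Pos s (zmon Pos s t u a b c d e f) =
      of_int (2 * a * (int CARD('n) + 2 * a - 2 + 2 * b + 2 * c)) * zmon Pos s t u (a - 1) b c d e f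
    + of_int (b * (b - 1)) * zmon Pos s t u a (b - 2) c (d + 1) e f
    + of_int (2 * b * c) * zmon Pos s t u a (b - 1) (c - 1) d (e + 1) f
    + of_int (c * (c - 1)) * zmon Pos s t u a b (c - 2) d e (f + 1)"
proof -
  let ?z = "zmon Pos s t u"
  have "const (eps Pos j) * der s j (der s j (?z a b c d e f)) = der s j (zmon_gradient Pos s t u j a b c d e f)" for j
    by (simp only: der_zmon[OF assms(1,2)] der_const_mult const_eps_square)
  then have "box_sym Pos s (?z a b c d e f) = (\<Sum>j\<in>UNIV. der s j (zmon_gradient Pos s t u j a b c d e f))"
    by (simp add: box_sym_def)
  also have "\<dots> = (\<Sum>j\<in>UNIV. 2 * of_int a * ?z (a - 1) b c d e f
      + 2 * of_int a * (var s j * der s j (?z (a - 1) b c d e f))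
      + of_int b * (var t j * der s j (?z a (b - 1) c d e f))
      + of_int c * (var u j * der s j (?z a b (c - 1) d e f)))"
  proof (rule sum.cong[OF refl])
    fix j :: 'n
    have k: "der s j (of_int k * S) = of_int k * der s j S" "der s j (2 * of_int k * S) = 2 * of_int k * der s j S" for k and S :: "'n symbol"
      using der_const_mult[of s j "of_int k" S] der_const_mult[of s j "2 * of_int k" S]
      by (simp_all add: const_int const_simps const_numeral)
    show "der s j (zmon_gradient Pos s t u j a b c d e f) = 2 * of_int a * ?z (a - 1) b c d e f
      + 2 * of_int a * (var s j * der s j (?z (a - 1) b c d e f))
      + of_int b * (var t j * der s j (?z a (b - 1) c d e f))
      + of_int c * (var u j * der s j (?z a b (c - 1) d e f))"
      unfolding zmon_gradient_def der_add k der_var_mult using assms(1,2) by (simp add: distrib_left)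
  qed
  also have "\<dots> = of_nat CARD('n) * (2 * of_int a * ?z (a - 1) b c d e f)
      + 2 * of_int a * euler_sym s (?z (a - 1) b c d e f)
      + of_int b * (\<Sum>j\<in>UNIV. var t j * der s j (?z a (b - 1) c d e f))
      + of_int c * (\<Sum>j\<in>UNIV. var u j * der s j (?z a b (c - 1) d e f))"
    by (simp add: sum.distrib sum_distrib_left euler_sym_def)
  also have "of_int b * (\<Sum>j\<in>UNIV. var t j * der s j (?z a (b - 1) c d e f))
    = 2 * of_int a * (of_int b * (R2 Pos s t * ?z (a - 1) (b - 1) c d e f))
      + of_int (b * (b - 1)) * (R2 Pos t t * ?z a (b - 2) c d e f)
      + of_int (b * c) * (R2 Pos t u * ?z a (b - 1) (c - 1) d e f)"
    unfolding contract_zmon[OF assms(1,2)] by (simp add: algebra_simps R2_commute[of Pos t s])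
  also have "of_int c * (\<Sum>j\<in>UNIV. var u j * der s j (?z a b (c - 1) d e f))
    = 2 * of_int a * (of_int c * (R2 Pos s u * ?z (a - 1) b (c - 1) d e f))
      + of_int (b * c) * (R2 Pos t u * ?z a (b - 1) (c - 1) d e f)
      + of_int (c * (c - 1)) * (R2 Pos u u * ?z a b (c - 2) d e f)"
    unfolding contract_zmon[OF assms(1,2)] by (simp add: algebra_simps R2_commute[of Pos u s] R2_commute[of Pos u t])
  finally show ?thesis
    unfolding zmon_steps(2,3) zmon_steps(4)[OF assms(3)] zmon_steps(5)[OF assms(4)] zmon_steps(6)[OF assms(5)]
      euler_zmon[OF assms(1,2)]
    by (simp add: algebra_simps)
qed

text \<open>The inversion operator of one slot sends a monomial to a combination of the covectors of the three
slots. The covector of the slot itself occurs both in the Laplacian term and in the gradient; the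
other two occur in the gradient only, where the degree operator and the weight act by a scalar.\<close>

lemma inv_zmon:
  fixes Pos :: "'n::finite set"
  assumes "s \<noteq> t" "s \<noteq> u" and "d \<ge> 0" "e \<ge> 0" "f \<ge> 0"
  shows "inv_sym Pos w i s (zmon Pos s t u a b c d e f) =
    - (var s i * (const (2 * of_int a * (2 * of_int a + real CARD('n) * (2 * w - 1))) * zmon Pos s t u (a - 1) b c d e f
         - const (of_int b * (of_int b - 1)) * zmon Pos s t u a (b - 2) c (d + 1) e f
         - const (2 * of_int b * of_int c) * zmon Pos s t u a (b - 1) (c - 1) d (e + 1) f
         - const (of_int c * (of_int c - 1)) * zmon Pos s t u a b (c - 2) d e (f + 1)))
    - var t i * (const (2 * of_int b * (2 * of_int a + of_int b - 1 + of_int c + real CARD('n) * w))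
         * zmon Pos s t u a (b - 1) c d e f)
    - var u i * (const (2 * of_int c * (2 * of_int a + of_int b + of_int c - 1 + real CARD('n) * w))
         * zmon Pos s t u a b (c - 1) d e f)"
proof -
  let ?z = "zmon Pos s t u" and ?d = "zmon_gradient Pos s t u i a b c d e f"
  have cd: "const (x - y) = const x - const y" for x y
    using const_simps(3)[of x "- y"] by (simp add: const_simps)
  have inv0: "inv_sym Pos w i s (?z a b c d e f) = var s i * box_sym Pos s (?z a b c d e f)
     - 2 * (euler_sym s ?d + const (w * real CARD('n)) * ?d)"
    unfolding inv_sym_def der_zmon[OF assms(1,2)] euler_mult euler_const
    by (simp add: distrib_left const_eps_square mult.assoc
        mult.left_commute[of "const (w * real CARD('n))" "const (eps Pos i)"])
  have eul0: "euler_sym s ?d = 2 * of_int a * (of_int (2 * a - 1 + b + c) * (var s i * ?z (a - 1) b c d e f))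
      + of_int b * (of_int (2 * a + b - 1 + c) * (var t i * ?z a (b - 1) c d e f))
      + of_int c * (of_int (2 * a + b + c - 1) * (var u i * ?z a b (c - 1) d e f))"
    using assms(1,2) unfolding zmon_gradient_def euler_add euler_mult euler_var euler_zmon[OF assms(1,2)]
    by (simp add: delta_def algebra_simps)
  show ?thesis
    unfolding inv0 eul0 box_zmon[OF assms] unfolding zmon_gradient_def
    by (simp add: cd const_simps const_int const_numeral const_of_nat algebra_simps)
qed

lemma derivation_scale: "derivation d \<Longrightarrow> derivation (\<lambda>S. x * d S)"
  by (simp add: derivation_def algebra_simps)

lemma derivation_minus: "derivation d \<Longrightarrow> derivation d' \<Longrightarrow> derivation (\<lambda>S. d S - d' S)"
  by (simp add: derivation_def algebra_simps)

lemma derivation_setsum: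
  "(\<And>i. i \<in> I \<Longrightarrow> derivation (d i)) \<Longrightarrow> derivation (\<lambda>S. \<Sum>i\<in>I. d i S)"
  by (induction I rule: infinite_finite_induct) (auto simp: derivation_def algebra_simps)

lemma euler_total_derivation: "derivation (\<lambda>S. \<Sum>s\<in>UNIV. euler_sym s S)"
  by (intro derivation_setsum euler_derivation)

lemma rot_total_derivation: "derivation (\<lambda>S. \<Sum>s\<in>UNIV. rot_sym Pos i j s S)"
  unfolding rot_sym_def
  by (intro derivation_setsum derivation_minus derivation_scale der_derivation)

lemma euler_R2: "(\<Sum>s\<in>UNIV. euler_sym s (R2 Pos t u)) = 2 * R2 Pos t u"
proof -
  have "(\<Sum>s\<in>UNIV. euler_sym s (R2 Pos t u)) = (\<Sum>j\<in>UNIV. \<Sum>s\<in>UNIV. var s j * der s j (R2 Pos t u))"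
    unfolding euler_sym_def by (rule sum.swap)
  also have "\<dots> = (\<Sum>j\<in>UNIV. 2 * (const (eps Pos j) * (var t j * var u j)))"
  proof (rule sum.cong[OF refl])
    fix j
    have "(\<Sum>s\<in>UNIV. var s j * der s j (R2 Pos t u)) = const (eps Pos j) *
        ((\<Sum>s\<in>UNIV. delta s t * (var s j * var u j)) + (\<Sum>s\<in>UNIV. delta s u * (var s j * var t j)))"
      by (simp only: der_R2 sum_distrib_left sum.distrib distrib_left mult_ac)
    then show "(\<Sum>s\<in>UNIV. var s j * der s j (R2 Pos t u)) = 2 * (const (eps Pos j) * (var t j * var u j))"
      unfolding delta_sum by (simp add: algebra_simps)
  qed
  finally show ?thesis by (simp add: R2_eq sum_distrib_left)
qed

lemma rot_R2: "(\<Sum>s\<in>UNIV. rot_sym Pos i j s (R2 Pos t u)) = 0"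
proof -
  have "(\<Sum>s\<in>UNIV. const (eps Pos i) * (var s j * der s i (R2 Pos t u))) = var t j * var u i + var u j * var t i"
    for i j
  proof -
    have "(\<Sum>s\<in>UNIV. const (eps Pos i) * (var s j * der s i (R2 Pos t u)))
      = (\<Sum>s\<in>UNIV. const (eps Pos i) * (const (eps Pos i) *
          (delta s t * (var s j * var u i) + delta s u * (var s j * var t i))))"
      unfolding der_R2 by (intro sum.cong refl) (simp add: algebra_simps)
    then show ?thesis by (simp add: const_eps_square sum.distrib)
  qed
  then show ?thesis by (simp add: rot_sym_def sum_subtractf)
qed

lemma derivation_zmon_homogeneous:
  assumes "derivation T" and "\<And>v w. T (R2 Pos v w) = k * R2 Pos v w"
  shows "T (zmon Pos s t u a b c d e f) = of_int (a + b + c + d + e + f) * k * zmon Pos s t u a b c d e f"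
proof -
  have *: "T (zpower (R2 Pos v w) m) = of_int m * k * zpower (R2 Pos v w) m" for v w m
  proof -
    have "T (zpower (R2 Pos v w) m) = k * (of_int m * (R2 Pos v w * zpower (R2 Pos v w) (m - 1)))"
      by (simp only: derivation_zpower[OF assms(1)] assms(2) mult_ac)
    then show ?thesis unfolding zpower_int_step by (simp only: mult_ac)
  qed
  show ?thesis
    unfolding zmon_def by (simp only: derivation_mult[OF assms(1)] *) (simp add: algebra_simps)
qed

text \<open>Exponents range over integers, so that the shifted indices of the recursion stay in one index type;
coefficients and monomials vanish outside the nonnegative ones.\<close>

definition exponents :: "int \<Rightarrow> (int \<times> int \<times> int \<times> int \<times> int \<times> int) set" where
  "exponents k = {(a,b,c,d,e,f). a \<ge> 0 \<and> b \<ge> 0 \<and> c \<ge> 0 \<and> d \<ge> 0 \<and> e \<ge> 0 \<and> f \<ge> 0 \<and> a + b + c + d + e + f = k}"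

lemma finite_exponents [simp]: "finite (exponents k)"
  by (rule finite_subset[of _ "{0..k} \<times> {0..k} \<times> {0..k} \<times> {0..k} \<times> {0..k} \<times> {0..k}"])
    (auto simp: exponents_def)

lemma zmon_neg: "\<not> (a \<ge> 0 \<and> b \<ge> 0 \<and> c \<ge> 0 \<and> d \<ge> 0 \<and> e \<ge> 0 \<and> f \<ge> 0) \<Longrightarrow> zmon Pos s t u a b c d e f = 0"
  by (auto simp: zmon_def zpower_def)

definition zmon_sum :: "'n set \<Rightarrow> int \<Rightarrow> (int \<Rightarrow> int \<Rightarrow> int \<Rightarrow> int \<Rightarrow> int \<Rightarrow> int \<Rightarrow> real) \<Rightarrow> 'n::finite symbol" where
  "zmon_sum Pos k A = (\<Sum>(a,b,c,d,e,f)\<in>exponents k. const (A a b c d e f) * zmon Pos Xi Eta Zeta a b c d e f)"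

text \<open>Reindexing a sum over monomials of degree \<open>k\<close> whose exponents are shifted by a fixed
vector of total \<open>-1\<close>. Indices that leave the range on one side contribute nothing,
because either the monomial or the coefficient vanishes there.\<close>

lemma zmon_sum_shift:
  assumes "da + db + dc + dd + de + df = -1"
  shows "(\<Sum>(a,b,c,d,e,f)\<in>exponents k. const (zcoef \<alpha> a b c d e f * C a b c d e f)
        * zmon Pos Xi Eta Zeta (a + da) (b + db) (c + dc) (d + dd) (e + de) (f + df))
    = zmon_sum Pos (k - 1) (\<lambda>a b c d e f. zcoef \<alpha> (a - da) (b - db) (c - dc) (d - dd) (e - de) (f - df)
        * C (a - da) (b - db) (c - dc) (d - dd) (e - de) (f - df))"
  unfolding zmon_sum_def
proof (rule sum.reindex_bij_witness_not_neutral[where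
      S' = "{v \<in> exponents k. (case v of (a,b,c,d,e,f) \<Rightarrow> (a + da, b + db, c + dc, d + dd, e + de, f + df)) \<notin> exponents (k - 1)}" and
      T' = "{v \<in> exponents (k - 1). (case v of (a,b,c,d,e,f) \<Rightarrow> (a - da, b - db, c - dc, d - dd, e - de, f - df)) \<notin> exponents k}" and
      i = "\<lambda>(a,b,c,d,e,f). (a - da, b - db, c - dc, d - dd, e - de, f - df)" and
      j = "\<lambda>(a,b,c,d,e,f). (a + da, b + db, c + dc, d + dd, e + de, f + df)"], goal_cases)
  case 1
  show ?case by (rule finite_subset[OF _ finite_exponents]) auto
next
  case 2
  show ?case by (rule finite_subset[OF _ finite_exponents]) auto
next
  case (7 v)
  obtain a b c d e f where v: "v = (a,b,c,d,e,f)" by (cases v)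
  have "\<not> (a + da \<ge> 0 \<and> b + db \<ge> 0 \<and> c + dc \<ge> 0 \<and> d + dd \<ge> 0 \<and> e + de \<ge> 0 \<and> f + df \<ge> 0)"
    using 7 assms unfolding v exponents_def by auto
  then show ?case unfolding v by (simp add: zmon_neg)
next
  case (8 v)
  obtain a b c d e f where v: "v = (a,b,c,d,e,f)" by (cases v)
  have "\<not> (a - da \<ge> 0 \<and> b - db \<ge> 0 \<and> c - dc \<ge> 0 \<and> d - dd \<ge> 0 \<and> e - de \<ge> 0 \<and> f - df \<ge> 0)"
    using 8 assms unfolding v exponents_def by auto
  then have "zcoef \<alpha> (a - da) (b - db) (c - dc) (d - dd) (e - de) (f - df) = 0"
    unfolding zcoef_def by (rule if_not_P)
  then show ?case unfolding v by (simp add: const_simps)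
qed (use assms in \<open>auto simp: exponents_def\<close>)

lemma zmon_sum_add: "zmon_sum Pos k A + zmon_sum Pos k B = zmon_sum Pos k (\<lambda>a b c d e f. A a b c d e f + B a b c d e f)"
  by (simp add: zmon_sum_def sum.distrib[symmetric] const_simps algebra_simps split_def)

lemma zmon_sum_uminus: "- zmon_sum Pos k A = zmon_sum Pos k (\<lambda>a b c d e f. - A a b c d e f)"
  by (simp add: zmon_sum_def sum_negf const_simps split_def)

lemma zmon_sum_diff: "zmon_sum Pos k A - zmon_sum Pos k B = zmon_sum Pos k (\<lambda>a b c d e f. A a b c d e f - B a b c d e f)"
  unfolding diff_conv_add_uminus zmon_sum_uminus zmon_sum_add ..

lemma zmon_sum_zero: "(\<And>a b c d e f. (a,b,c,d,e,f) \<in> exponents k \<Longrightarrow> A a b c d e f = 0) \<Longrightarrow> zmon_sum Pos k A = 0"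
  unfolding zmon_sum_def by (rule sum.neutral) (auto simp: const_simps)

lemma B_symbol_zmon_sum: "B_symbol Pos k \<alpha> = zmon_sum Pos (int k) (zcoef \<alpha>)"
  unfolding B_symbol_def zmon_sum_def
  by (rule sum.reindex_bij_witness[where
        j = "\<lambda>(a,b,c,d,e,f). (int a, int b, int c, int d, int e, int f)" and
        i = "\<lambda>(a,b,c,d,e,f). (nat a, nat b, nat c, nat d, nat e, nat f)"])
    (auto simp: exponents_def zcoef_def Rmon_def zmon_def zpower_def)

lemma derivation_const_mult:
  "derivation T \<Longrightarrow> (\<And>c. T (const c) = 0) \<Longrightarrow> T (const c * S) = const c * T S"
  by (simp add: derivation_mult)

lemma derivation_zmon_sum_homogeneous:
  assumes "derivation T" and "\<And>v w. T (R2 Pos v w) = l * R2 Pos v w" and "\<And>c. T (const c) = 0"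
  shows "T (zmon_sum Pos k A) = of_int k * l * zmon_sum Pos k A"
  unfolding zmon_sum_def derivation_sum[OF assms(1)] sum_distrib_left
proof (rule sum.cong[OF refl], clarify)
  fix a b c d e f assume "(a,b,c,d,e,f) \<in> exponents k"
  then have k: "a + b + c + d + e + f = k" by (simp add: exponents_def)
  show "T (const (A a b c d e f) * zmon Pos Xi Eta Zeta a b c d e f)
      = of_int k * l * (const (A a b c d e f) * zmon Pos Xi Eta Zeta a b c d e f)"
    unfolding derivation_const_mult[OF assms(1,3)] derivation_zmon_homogeneous[OF assms(1,2)] k
    by (simp add: mult_ac)
qed

lemma inv_sym_add: "inv_sym Pos w i s (S + T) = inv_sym Pos w i s S + inv_sym Pos w i s T"
  by (simp add: inv_sym_def box_sym_def euler_sym_def der_add sum.distrib algebra_simps)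

lemma inv_sym_const_mult: "inv_sym Pos w i s (const c * S) = const c * inv_sym Pos w i s S"
  for S :: "'m::finite symbol"
proof -
  have "box_sym Pos s (const c * S) = const c * box_sym Pos s S"
    by (simp add: box_sym_def der_const_mult sum_distrib_left mult.left_commute)
  moreover have "euler_sym s (const c * T) = const c * euler_sym s T" for T :: "'m symbol"
    by (simp add: euler_sym_def der_const_mult sum_distrib_left mult.left_commute)
  ultimately show ?thesis
    unfolding inv_sym_def der_const_mult by (simp add: right_diff_distrib distrib_left mult.left_commute)
qed

lemma inv_sym_sum: "inv_sym Pos w i s (\<Sum>v\<in>V. G v) = (\<Sum>v\<in>V. inv_sym Pos w i s (G v))"
proof (induction V rule: infinite_finite_induct)
  case (insert x F)
  then show ?case by (simp add: inv_sym_add)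
qed (use inv_sym_const_mult[of Pos w i s 0 0] in \<open>simp_all add: const_simps\<close>)

lemma zmon_permute:
  "zmon Pos Xi Eta Zeta a b c d e f = zmon Pos Eta Xi Zeta d b e a c f"
  "zmon Pos Xi Eta Zeta a b c d e f = zmon Pos Zeta Eta Xi f e c d b a"
  unfolding zmon_def R2_commute[of Pos Eta Xi] R2_commute[of Pos Zeta Xi] R2_commute[of Pos Zeta Eta]
  by (simp_all only: mult_ac)

definition shifted_sum where
  "shifted_sum Pos \<alpha> k C da db dc dd de df = (\<Sum>(a,b,c,d,e,f)\<in>exponents k. const (zcoef \<alpha> a b c d e f)
      * (const (C a b c d e f) * zmon Pos Xi Eta Zeta (a + da) (b + db) (c + dc) (d + dd) (e + de) (f + df)))"

lemma zmon_sum_shifted_sum: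
  assumes "da + db + dc + dd + de + df = -1"
  shows "shifted_sum Pos \<alpha> k C da db dc dd de df
    = zmon_sum Pos (k - 1) (\<lambda>a b c d e f. zcoef \<alpha> (a - da) (b - db) (c - dc) (d - dd) (e - de) (f - df)
        * C (a - da) (b - db) (c - dc) (d - dd) (e - de) (f - df))"
  unfolding zmon_sum_shift[OF assms, symmetric] shifted_sum_def
  by (rule sum.cong) (auto simp: const_simps mult.assoc)

text \<open>Collecting monomials, the total inversion operator applied to the symbol is a combination of the
three covectors \<open>\<xi>\<^sub>i\<close>, \<open>\<eta>\<^sub>i\<close>, \<open>\<zeta>\<^sub>i\<close>, and the coefficient of each monomial in the three factors is the left-hand side of one of the three
induction formulas.\<close>

lemma inv_B_symbol:
  fixes Pos :: "'n::finite set" and w :: "slot \<Rightarrow> real"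
  assumes "induction_formulas CARD('n) (w Xi) (w Eta) (w Zeta) k \<alpha>"
  shows "(\<Sum>s\<in>UNIV. inv_sym Pos (w s) i s (B_symbol Pos k \<alpha>)) = 0"
proof -
  let ?Z = "zmon Pos Xi Eta Zeta" and ?n = "real CARD('n)" and ?A = "zcoef \<alpha>"
  note formulas = assms[unfolded induction_formulas_def Let_def, rule_format, of a b c d e f for a b c d e f]
  have bounds: "0 \<le> a \<and> 0 \<le> b \<and> 0 \<le> c \<and> 0 \<le> d \<and> 0 \<le> e \<and> 0 \<le> f \<and> a + b + c + d + e + f = int k - 1"
    if "(a, b, c, d, e, f) \<in> exponents (int k - 1)" for a b c d e f
    using that by (simp add: exponents_def)
  have shifts: "(-1) + 0 + 0 + 0 + 0 + 0 = (-1 :: int)"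
    "0 + (-2) + 0 + 1 + 0 + 0 = (-1 :: int)"
    "0 + (-1) + (-1) + 0 + 1 + 0 = (-1 :: int)"
    "0 + 0 + (-2) + 0 + 0 + 1 = (-1 :: int)"
    "0 + (-1) + 0 + 0 + 0 + 0 = (-1 :: int)"
    "0 + 0 + (-1) + 0 + 0 + 0 = (-1 :: int)"
    "0 + 0 + 0 + (-1) + 0 + 0 = (-1 :: int)"
    "1 + (-2) + 0 + 0 + 0 + 0 = (-1 :: int)"
    "0 + (-1) + 1 + 0 + (-1) + 0 = (-1 :: int)"
    "0 + 0 + 0 + 0 + (-2) + 1 = (-1 :: int)"
    "0 + 0 + 0 + 0 + (-1) + 0 = (-1 :: int)"
    "0 + 0 + 0 + 0 + 0 + (-1) = (-1 :: int)"
    "0 + 0 + 0 + 1 + (-2) + 0 = (-1 :: int)"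
    "0 + 1 + (-1) + 0 + (-1) + 0 = (-1 :: int)"
    "1 + 0 + (-2) + 0 + 0 + 0 = (-1 :: int)"
    by simp_all
  have formula1: "shifted_sum Pos \<alpha> (int k) (\<lambda>a b c d e f. 2 * of_int a * (2 * of_int a + real CARD('n) * (2 * w Xi - 1))) (-1) 0 0 0 0 0
          - shifted_sum Pos \<alpha> (int k) (\<lambda>a b c d e f. of_int b * (of_int b - 1)) 0 (-2) 0 1 0 0
          - shifted_sum Pos \<alpha> (int k) (\<lambda>a b c d e f. 2 * of_int b * of_int c) 0 (-1) (-1) 0 1 0
          - shifted_sum Pos \<alpha> (int k) (\<lambda>a b c d e f. of_int c * (of_int c - 1)) 0 0 (-2) 0 0 1
          + shifted_sum Pos \<alpha> (int k) (\<lambda>a b c d e f. 2 * of_int b * (2 * of_int d + of_int b - 1 + of_int e + real CARD('n) * w Eta)) 0 (-1) 0 0 0 0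
          + shifted_sum Pos \<alpha> (int k) (\<lambda>a b c d e f. 2 * of_int c * (2 * of_int f + of_int e + of_int c - 1 + real CARD('n) * w Zeta)) 0 0 (-1) 0 0 0 = 0"
    (is "?F1 = 0")
    unfolding shifts[THEN zmon_sum_shifted_sum] zmon_sum_add zmon_sum_diff
  proof (rule zmon_sum_zero, goal_cases)
    case (1 a b c d e f)
    from formulas[OF bounds[OF this], THEN conjunct1] show ?case by (simp add: algebra_simps)
  qed
  have formula2: "shifted_sum Pos \<alpha> (int k) (\<lambda>a b c d e f. 2 * of_int d * (2 * of_int d + real CARD('n) * (2 * w Eta - 1))) 0 0 0 (-1) 0 0
          - shifted_sum Pos \<alpha> (int k) (\<lambda>a b c d e f. of_int b * (of_int b - 1)) 1 (-2) 0 0 0 0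
          - shifted_sum Pos \<alpha> (int k) (\<lambda>a b c d e f. 2 * of_int b * of_int e) 0 (-1) 1 0 (-1) 0
          - shifted_sum Pos \<alpha> (int k) (\<lambda>a b c d e f. of_int e * (of_int e - 1)) 0 0 0 0 (-2) 1
          + shifted_sum Pos \<alpha> (int k) (\<lambda>a b c d e f. 2 * of_int b * (2 * of_int a + of_int b - 1 + of_int c + real CARD('n) * w Xi)) 0 (-1) 0 0 0 0
          + shifted_sum Pos \<alpha> (int k) (\<lambda>a b c d e f. 2 * of_int e * (2 * of_int f + of_int e - 1 + of_int c + real CARD('n) * w Zeta)) 0 0 0 0 (-1) 0 = 0"
    (is "?F2 = 0")
    unfolding shifts[THEN zmon_sum_shifted_sum] zmon_sum_add zmon_sum_diff
  proof (rule zmon_sum_zero, goal_cases)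
    case (1 a b c d e f)
    from formulas[OF bounds[OF this], THEN conjunct2, THEN conjunct1] show ?case by (simp add: algebra_simps)
  qed
  have formula3: "shifted_sum Pos \<alpha> (int k) (\<lambda>a b c d e f. 2 * of_int f * (2 * of_int f + real CARD('n) * (2 * w Zeta - 1))) 0 0 0 0 0 (-1)
          - shifted_sum Pos \<alpha> (int k) (\<lambda>a b c d e f. of_int e * (of_int e - 1)) 0 0 0 1 (-2) 0
          - shifted_sum Pos \<alpha> (int k) (\<lambda>a b c d e f. 2 * of_int e * of_int c) 0 1 (-1) 0 (-1) 0
          - shifted_sum Pos \<alpha> (int k) (\<lambda>a b c d e f. of_int c * (of_int c - 1)) 1 0 (-2) 0 0 0
          + shifted_sum Pos \<alpha> (int k) (\<lambda>a b c d e f. 2 * of_int e * (2 * of_int d + of_int b + of_int e - 1 + real CARD('n) * w Eta)) 0 0 0 0 (-1) 0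
          + shifted_sum Pos \<alpha> (int k) (\<lambda>a b c d e f. 2 * of_int c * (2 * of_int a + of_int b + of_int c - 1 + real CARD('n) * w Xi)) 0 0 (-1) 0 0 0 = 0"
    (is "?F3 = 0")
    unfolding shifts[THEN zmon_sum_shifted_sum] zmon_sum_add zmon_sum_diff
  proof (rule zmon_sum_zero, goal_cases)
    case (1 a b c d e f)
    from formulas[OF bounds[OF this], THEN conjunct2, THEN conjunct2] show ?case by (simp add: algebra_simps)
  qed
  have "(\<Sum>s\<in>UNIV. inv_sym Pos (w s) i s (B_symbol Pos k \<alpha>))
      = (\<Sum>(a,b,c,d,e,f)\<in>exponents (int k). \<Sum>s\<in>UNIV. const (?A a b c d e f) * inv_sym Pos (w s) i s (?Z a b c d e f))"
    unfolding B_symbol_zmon_sum zmon_sum_def inv_sym_sum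
    by (subst sum.swap) (auto simp: inv_sym_const_mult intro!: sum.cong)
  also have "\<dots> = - var Xi i * ?F1 + - var Eta i * ?F2 + - var Zeta i * ?F3"
    unfolding shifted_sum_def sum_distrib_left sum.distrib[symmetric] sum_subtractf[symmetric]
  proof (rule sum.cong[OF refl], clarify, goal_cases)
    case (1 a b c d e f)
    then have nn: "a \<ge> 0" "b \<ge> 0" "c \<ge> 0" "d \<ge> 0" "e \<ge> 0" "f \<ge> 0" by (auto simp: exponents_def)
    \<comment> \<open>The three slots see the same monomial, each with its own naming of the exponents.\<close>
    have norm: "x + 0 = x" "x + -1 = x - 1" "x + -2 = x - 2" for x :: int by simp_all
    have xi: "inv_sym Pos (w Xi) i Xi (?Z a b c d e f) = - (var Xi i * (const (2 * of_int a * (2 * of_int a + ?n * (2 * w Xi - 1))) * ?Z (a - 1) b c d e f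
         - const (of_int b * (of_int b - 1)) * ?Z a (b - 2) c (d + 1) e f
         - const (2 * of_int b * of_int c) * ?Z a (b - 1) (c - 1) d (e + 1) f
         - const (of_int c * (of_int c - 1)) * ?Z a b (c - 2) d e (f + 1)))
      - var Eta i * (const (2 * of_int b * (2 * of_int a + of_int b - 1 + of_int c + ?n * w Xi)) * ?Z a (b - 1) c d e f)
      - var Zeta i * (const (2 * of_int c * (2 * of_int a + of_int b + of_int c - 1 + ?n * w Xi)) * ?Z a b (c - 1) d e f)"
      using nn by (intro inv_zmon) auto
    have eta: "inv_sym Pos (w Eta) i Eta (?Z a b c d e f) = - (var Eta i * (const (2 * of_int d * (2 * of_int d + ?n * (2 * w Eta - 1))) * ?Z a b c (d - 1) e f
         - const (of_int b * (of_int b - 1)) * ?Z (a + 1) (b - 2) c d e f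
         - const (2 * of_int b * of_int e) * ?Z a (b - 1) (c + 1) d (e - 1) f
         - const (of_int e * (of_int e - 1)) * ?Z a b c d (e - 2) (f + 1)))
      - var Xi i * (const (2 * of_int b * (2 * of_int d + of_int b - 1 + of_int e + ?n * w Eta)) * ?Z a (b - 1) c d e f)
      - var Zeta i * (const (2 * of_int e * (2 * of_int d + of_int b + of_int e - 1 + ?n * w Eta)) * ?Z a b c d (e - 1) f)"
      unfolding zmon_permute(1) using nn by (intro inv_zmon) auto
    have zeta: "inv_sym Pos (w Zeta) i Zeta (?Z a b c d e f) = - (var Zeta i * (const (2 * of_int f * (2 * of_int f + ?n * (2 * w Zeta - 1))) * ?Z a b c d e (f - 1)
         - const (of_int e * (of_int e - 1)) * ?Z a b c (d + 1) (e - 2) f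
         - const (2 * of_int e * of_int c) * ?Z a (b + 1) (c - 1) d (e - 1) f
         - const (of_int c * (of_int c - 1)) * ?Z (a + 1) b (c - 2) d e f))
      - var Eta i * (const (2 * of_int e * (2 * of_int f + of_int e - 1 + of_int c + ?n * w Zeta)) * ?Z a b c d (e - 1) f)
      - var Xi i * (const (2 * of_int c * (2 * of_int f + of_int e + of_int c - 1 + ?n * w Zeta)) * ?Z a b (c - 1) d e f)"
      unfolding zmon_permute(2) using nn by (intro inv_zmon) auto
    show ?case
      unfolding sum_slot xi eta zeta norm
      by (simp only: mult_minus_left mult_minus_right distrib_left[of "const (?A a b c d e f)"]
          right_diff_distrib[of "const (?A a b c d e f)"] distrib_left[of "var s i" for s]
          right_diff_distrib[of "var s i" for s] diff_conv_add_uminus minus_add_distrib minus_minus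
          mult.left_commute[of "const (?A a b c d e f)" "var _ _"] add_ac)
  qed
  also have "\<dots> = 0" by (simp only: formula1 formula2 formula3) simp
  finally show ?thesis .
qed

section \<open>Solutions of the recursion that involve two arguments\<close>

text \<open>For coefficients supported on \<open>c = e = f = 0\<close> the third formula is void and the first
two become the recursions \<open>defect1 = 0\<close> and \<open>defect2 = 0\<close> in the exponents
\<open>a, b, d\<close>. For generic weights the first determines everything from the row
\<open>a = 0\<close>, and on that row the second is the two-term recursion solved here.\<close>

fun bin_coeff_edge :: "real \<Rightarrow> real \<Rightarrow> real \<Rightarrow> nat \<Rightarrow> nat \<Rightarrow> real" where
  "bin_coeff_edge n l g b 0 = 1"
| "bin_coeff_edge n l g b (Suc d) = - (real b + 1) * (real b + n * l) * bin_coeff_edge n l g (Suc b) d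
     / ((real d + 1) * (2 * (real d + 1) + n * (2 * g - 1)))"

fun bin_coeff :: "real \<Rightarrow> real \<Rightarrow> real \<Rightarrow> nat \<Rightarrow> nat \<Rightarrow> nat \<Rightarrow> real" where
  "bin_coeff n l g 0 b d = bin_coeff_edge n l g b d"
| "bin_coeff n l g (Suc a) b d =
     ((real b + 2) * (real b + 1) * (if d = 0 then 0 else bin_coeff n l g a (b + 2) (d - 1))
       - 2 * (real b + 1) * (real b + 2 * real d + n * g) * bin_coeff n l g a (b + 1) d)
     / (2 * (real a + 1) * (2 * (real a + 1) + n * (2 * l - 1)))"

definition defect1 :: "real \<Rightarrow> real \<Rightarrow> real \<Rightarrow> (nat \<Rightarrow> nat \<Rightarrow> nat \<Rightarrow> real) \<Rightarrow> nat \<Rightarrow> nat \<Rightarrow> nat \<Rightarrow> real" where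
  "defect1 n l g \<beta> a b d = 2 * (real a + 1) * (2 * (real a + 1) + n * (2 * l - 1)) * \<beta> (a + 1) b d
     - (real b + 2) * (real b + 1) * (if d = 0 then 0 else \<beta> a (b + 2) (d - 1))
     + 2 * (real b + 1) * (real b + 2 * real d + n * g) * \<beta> a (b + 1) d"

definition defect2 :: "real \<Rightarrow> real \<Rightarrow> real \<Rightarrow> (nat \<Rightarrow> nat \<Rightarrow> nat \<Rightarrow> real) \<Rightarrow> nat \<Rightarrow> nat \<Rightarrow> nat \<Rightarrow> real" where
  "defect2 n l g \<beta> a b d = 2 * (real d + 1) * (2 * (real d + 1) + n * (2 * g - 1)) * \<beta> a b (d + 1)
     - (real b + 2) * (real b + 1) * (if a = 0 then 0 else \<beta> (a - 1) (b + 2) d)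
     + 2 * (real b + 1) * (real b + 2 * real a + n * l) * \<beta> a (b + 1) d"

text \<open>The polynomial identity behind the commutation of the two recursions. It reflects the fact that the
inversions commute with each other: applying two of them to a symbol of two covectors and
antisymmetrizing gives \<open>(D\<^sub>2 + 4\<partial>\<^sub>b) D\<^sub>1 = (D\<^sub>1 + 4\<partial>\<^sub>b) D\<^sub>2\<close>, where \<open>\<partial>\<^sub>b\<close>
is the derivative with respect to the contraction of the two covectors and \<open>D\<^sub>1\<close>, \<open>D\<^sub>2\<close> are
the operators of the two recursions.\<close>

lemma defect1_defect2_commute_real:
  fixes A B K n l g p q r s t u v :: real
  defines "cl \<equiv> \<lambda>x. 2 * (x + 1) * (2 * (x + 1) + n * (2 * l - 1))"
    and "cg \<equiv> \<lambda>x. 2 * (x + 1) * (2 * (x + 1) + n * (2 * g - 1))"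
    and "U \<equiv> \<lambda>x. (x + 2) * (x + 1)"
    and "V \<equiv> \<lambda>x y. 2 * (x + 1) * (x + 2 * y + n * g)"
    and "W \<equiv> \<lambda>x y. 2 * (x + 1) * (x + 2 * y + n * l)"
  shows "cl A * (cg K * p - U B * q + W B (A + 1) * r)
      - U B * (cg (K - 1) * q - U (B + 2) * s + W (B + 2) A * t)
      + V B K * (cg K * u - U (B + 1) * v + W (B + 1) A * q)
      + 4 * (B + 1) * (cg K * u - U (B + 1) * v + W (B + 1) A * q)
    = cg K * (cl A * p - U B * q + V B (K + 1) * u)
      - U B * (cl (A - 1) * q - U (B + 2) * s + V (B + 2) K * v)
      + W B A * (cl A * r - U (B + 1) * t + V (B + 1) K * q)
      + 4 * (B + 1) * (cl A * r - U (B + 1) * t + V (B + 1) K * q)"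
  unfolding cl_def cg_def U_def V_def W_def by algebra

lemma defect1_defect2_commute:
  "defect1 n l g (defect2 n l g \<beta>) a b d + 4 * (real b + 1) * defect2 n l g \<beta> a (b + 1) d
   = defect2 n l g (defect1 n l g \<beta>) a b d + 4 * (real b + 1) * defect1 n l g \<beta> a (b + 1) d"
proof -
  have nats: "real (x + 1) = real x + 1" "real (x + 2) = real x + 2" "x + 1 + 1 = x + 2" "x + 2 + 1 = x + 3"
    "x + 1 + 2 = x + 3" "x + 2 + 2 = x + 4" for x by simp_all
  have pred: "x = 0 \<or> (\<exists>y. x = y + 1)" for x :: nat by (cases x) auto
  have simps: "x + 1 \<noteq> 0" "(x + 1) - 1 = x" "x + 2 \<noteq> 0" "x + 2 - 1 = x + 1" for x :: nat by simp_all
  have p1: "real x + 1 - 1 = real x" "0 - 1 + 1 = (0::real)" "real x + 1 + 1 = real x + 2" "0 + 1 = (1::nat)"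
    "0 + 1 = (1::real)" "(1::nat) \<noteq> 0" "1 - 1 = (0::nat)" "0 + 2 = (2::nat)" for x by simp_all
  note comm = defect1_defect2_commute_real[of "real a" n l "real d" g "\<beta> (a + 1) b (d + 1)" "real b" "\<beta> a (b + 2) d"
    "\<beta> (a + 1) (b + 1) d" "if a = 0 \<or> d = 0 then 0 else \<beta> (a - 1) (b + 4) (d - 1)"
    "if d = 0 then 0 else \<beta> a (b + 3) (d - 1)" "\<beta> a (b + 1) (d + 1)" "if a = 0 then 0 else \<beta> (a - 1) (b + 3) d"]
  show ?thesis
    using pred[of a] pred[of d] comm
    by (elim disjE exE; simp only: defect1_def defect2_def nats simps p1 if_True if_False refl simp_thms of_nat_0 of_nat_1
       mult_zero_left mult_zero_right diff_0_right add_0_left add_0_right)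
qed

lemma bin_coeff_defect1:
  assumes "\<And>a :: nat. 2 * (real a + 1) + n * (2 * l - 1) \<noteq> 0"
  shows "defect1 n l g (bin_coeff n l g) a b d = 0"
proof -
  have "2 * (real a + 1) * (2 * (real a + 1) + n * (2 * l - 1)) \<noteq> 0" using assms[of a] by auto
  then show ?thesis unfolding defect1_def by simp
qed

text \<open>The overdetermined system is consistent: by the commutation relation, the defect in the second
recursion solves a homogeneous recursion in \<open>a\<close> with invertible leading coefficient, and
it vanishes on the row \<open>a = 0\<close> by the choice of that row.\<close>

lemma bin_coeff_defect2:
  assumes l: "\<And>a :: nat. 2 * (real a + 1) + n * (2 * l - 1) \<noteq> 0"
    and g: "\<And>a :: nat. 2 * (real a + 1) + n * (2 * g - 1) \<noteq> 0"
  shows "defect2 n l g (bin_coeff n l g) a b d = 0"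
proof (induction a arbitrary: b d)
  case 0
  have "(real d + 1) * (2 * (real d + 1) + n * (2 * g - 1)) \<noteq> 0" using g[of d] by auto
  moreover have "real d + 1 \<noteq> 0" by linarith
  ultimately show ?case unfolding defect2_def by (simp add: field_simps del: of_nat_Suc)
next
  case (Suc a)
  have "defect1 n l g (defect2 n l g (bin_coeff n l g)) a b d = 0"
    using defect1_defect2_commute[of n l g "bin_coeff n l g" a b d] Suc.IH bin_coeff_defect1[OF l, of g]
    by (simp add: defect2_def[of n l g "defect1 n l g (bin_coeff n l g)"])
  then have "2 * (real a + 1) * (2 * (real a + 1) + n * (2 * l - 1)) * defect2 n l g (bin_coeff n l g) (Suc a) b d = 0"
    using Suc.IH by (simp add: defect1_def[of n l g "defect2 n l g (bin_coeff n l g)"])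
  moreover have "2 * (real a + 1) * (2 * (real a + 1) + n * (2 * l - 1)) \<noteq> 0" using l[of a] by auto
  ultimately show ?case by (metis mult_eq_0_iff)
qed

definition binary_coeffs :: "real \<Rightarrow> real \<Rightarrow> real \<Rightarrow> coeffs" where
  "binary_coeffs n l g a b c d e f = (if c = 0 \<and> e = 0 \<and> f = 0 then bin_coeff n l g a b d else 0)"

lemma binary_coeffs_induction:
  assumes l: "\<And>a :: nat. 2 * (real a + 1) + real n * (2 * l - 1) \<noteq> 0"
    and g: "\<And>a :: nat. 2 * (real a + 1) + real n * (2 * g - 1) \<noteq> 0"
  shows "induction_formulas n l g t k (binary_coeffs n l g)"
proof -
  have z: "zcoef (binary_coeffs n l g) a b c d e f
      = (if a \<ge> 0 \<and> b \<ge> 0 \<and> d \<ge> 0 \<and> c = 0 \<and> e = 0 \<and> f = 0 then bin_coeff n l g (nat a) (nat b) (nat d) else 0)"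
    for a b c d e f
    by (auto simp: zcoef_def binary_coeffs_def)
  show ?thesis
    unfolding induction_formulas_def Let_def
  proof (intro allI impI, goal_cases)
    case (1 a b c d e f)
    then have nn: "a \<ge> 0" "b \<ge> 0" "c \<ge> 0" "d \<ge> 0" "e \<ge> 0" "f \<ge> 0" by auto
    show ?case
    proof (cases "c = 0 \<and> e = 0 \<and> f = 0")
      case True
      obtain a' b' d' where abd: "a = int a'" "b = int b'" "d = int d'"
        using nn nonneg_int_cases by metis
      have nats: "nat (int x + 1) = x + 1" "nat (int x + 2) = x + 2" "nat (int x - 1) = x - 1"
        "nat (1 + int x) = Suc x" "nat (2 + int x) = Suc (Suc x)" for x
        by simp_all
      show ?thesis
        using bin_coeff_defect1[OF l, of g a' b' d'] bin_coeff_defect2[OF l g, of a' b' d'] True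
        unfolding defect1_def defect2_def abd
        by (auto simp: z nats algebra_simps split: if_splits)
    next
      case False
      then show ?thesis using nn by (auto simp: z)
    qed
  qed
qed

section \<open>The operators do not vanish\<close>

text \<open>On exponentials every derivative is a scalar, so the operator acts by the value of its symbol at
the covectors of the exponentials.\<close>

lift_definition sf_exp :: "real^'n \<Rightarrow> 'n::finite sfun" is "\<lambda>c x. exp (c \<bullet> x)" by (rule smooth_exp)

lemma sf_pd_exp: "sf_pd i (sf_exp c) = sf_const (c $ i) * sf_exp c"
  by (rule sf_eqI) (simp add: sf_exp.rep_eq pd_exp)

definition pairing :: "'n set \<Rightarrow> real^'n \<Rightarrow> real^'n \<Rightarrow> real" where
  "pairing Pos x y = (\<Sum>i\<in>UNIV. eps Pos i * (x $ i * y $ i))"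

lemma sf_const_sum: "sf_const (\<Sum>i\<in>I. F i) = (\<Sum>i\<in>I. sf_const (F i))"
  by (rule sf_eqI) simp

lemma sf_op_R2_exp:
  "sf_op (R2 Pos s t * S) (\<lambda>r. sf_exp (\<nu> r)) = sf_const (pairing Pos (\<nu> s) (\<nu> t)) * sf_op S (\<lambda>r. sf_exp (\<nu> r))"
proof -
  have v: "sf_op (var s i * S) (\<lambda>r. sf_exp (\<nu> r)) = sf_const (\<nu> s $ i) * sf_op S (\<lambda>r. sf_exp (\<nu> r))" for s i S
    using sf_op_slot_const[of S "\<lambda>r. sf_exp (\<nu> r)" s "\<nu> s $ i" "sf_exp (\<nu> s)"]
    by (simp add: sf_op_var_mult sf_pd_exp fun_upd_idem[of "\<lambda>r. sf_exp (\<nu> r)" s "sf_exp (\<nu> s)"] del: fun_upd_apply)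
  show ?thesis
    unfolding R2_eq sum_distrib_right sf_op_sum pairing_def sf_const_sum
    by (rule sum.cong) (simp_all add: mult.assoc sf_op_const_mult v sf_const_simps)
qed

lemma sf_op_R2_power_exp:
  "sf_op (R2 Pos s t ^ m * S) (\<lambda>r. sf_exp (\<nu> r)) = sf_const (pairing Pos (\<nu> s) (\<nu> t) ^ m) * sf_op S (\<lambda>r. sf_exp (\<nu> r))"
  by (induction m) (simp_all add: sf_const_simps mult.assoc sf_op_R2_exp)

lemma sf_op_B_symbol_exp:
  "sf_apply (sf_op (B_symbol Pos k \<alpha>) (\<lambda>r. sf_exp (\<nu> r))) 0 =
    (\<Sum>(a,b,c,d,e,f) \<in> {(a,b,c,d,e,f). a + b + c + d + e + f = k}.
      \<alpha> a b c d e f * (pairing Pos (\<nu> Xi) (\<nu> Xi) ^ a * pairing Pos (\<nu> Xi) (\<nu> Eta) ^ b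
        * pairing Pos (\<nu> Xi) (\<nu> Zeta) ^ c * pairing Pos (\<nu> Eta) (\<nu> Eta) ^ d
        * pairing Pos (\<nu> Eta) (\<nu> Zeta) ^ e * pairing Pos (\<nu> Zeta) (\<nu> Zeta) ^ f))"
proof -
  have "sf_op (Rmon Pos a b c d e f * 1) (\<lambda>r. sf_exp (\<nu> r)) =
    sf_const (pairing Pos (\<nu> Xi) (\<nu> Xi) ^ a * pairing Pos (\<nu> Xi) (\<nu> Eta) ^ b
        * pairing Pos (\<nu> Xi) (\<nu> Zeta) ^ c * pairing Pos (\<nu> Eta) (\<nu> Eta) ^ d
        * pairing Pos (\<nu> Eta) (\<nu> Zeta) ^ e * pairing Pos (\<nu> Zeta) (\<nu> Zeta) ^ f)
      * sf_op 1 (\<lambda>r. sf_exp (\<nu> r))" for a b c d e f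
    unfolding Rmon_def mult.assoc sf_op_R2_power_exp by (simp add: sf_const_simps mult.assoc)
  moreover have "sf_apply (sf_op 1 (\<lambda>r. sf_exp (\<nu> r))) 0 = 1"
    using sf_op_const[of 1 "\<lambda>r. sf_exp (\<nu> r)"] by (simp add: const_simps sf_exp.rep_eq)
  ultimately show ?thesis
    unfolding B_symbol_def sf_op_sum split_def sf_op_const_mult by simp
qed

text \<open>The value on exponentials with covectors \<open>s e\<^sub>i + t e\<^sub>j\<close>, \<open>e\<^sub>i\<close> and \<open>0\<close> is a
polynomial in \<open>s\<close> and \<open>t\<close>; the two distinct directions make the square of the
first covector vary freely when \<open>s\<close> is fixed. If the polynomial were zero, so would be
its part without that square, which is a polynomial in \<open>s\<close> whose leading coefficient is
the first entry of the row \<open>a = 0\<close>, namely \<open>1\<close>.\<close>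

lemma nonzero_binary:
  fixes Pos :: "'n::finite set"
  assumes "CARD('n) > 1"
  shows "nonzero_op (B_op Pos k (binary_coeffs n l g))"
proof (rule ccontr)
  assume zero: "\<not> nonzero_op (B_op Pos k (binary_coeffs n l g))"
  obtain i j :: 'n where ij: "i \<noteq> j"
    using assms card_le_Suc0_iff_eq[of "UNIV :: 'n set"] by auto
  define C where "C a b = bin_coeff n l g a b (k - a - b)" for a b
  have sum0: "(\<Sum>a\<le>k. (\<Sum>b\<le>k - a. C a b * (eps Pos i * s) ^ b * eps Pos i ^ (k - a - b))
      * (eps Pos i * s\<^sup>2 + eps Pos j * t\<^sup>2) ^ a) = 0" for s t
  proof -
    define x where "x = s *\<^sub>R axis i 1 + t *\<^sub>R (axis j 1 :: real^'n)"
    define y where "y = (axis i 1 :: real^'n)"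
    define \<nu> where "\<nu> = case_slot x y (0 :: real^'n)"
    have two: "(\<Sum>m\<in>UNIV. F m) = F i + F j" if "\<And>m. m \<noteq> i \<Longrightarrow> m \<noteq> j \<Longrightarrow> F m = 0" for F :: "'n \<Rightarrow> real"
      using sum.mono_neutral_right[of UNIV "{i,j}" F] that ij by auto
    have xx: "pairing Pos x x = eps Pos i * s\<^sup>2 + eps Pos j * t\<^sup>2"
      unfolding pairing_def by (subst two) (use ij in \<open>auto simp: x_def axis_def power2_eq_square\<close>)
    have xy: "pairing Pos x y = eps Pos i * s"
      unfolding pairing_def by (subst two) (use ij in \<open>auto simp: x_def y_def axis_def\<close>)
    have yy: "pairing Pos y y = eps Pos i"
      unfolding pairing_def by (subst two) (use ij in \<open>auto simp: y_def axis_def\<close>)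
    have "0 = sf_apply (sf_op (B_symbol Pos k (binary_coeffs n l g)) (\<lambda>r. sf_exp (\<nu> r))) 0"
      using zero sf_smooth unfolding nonzero_op_def symbol_op_op[symmetric] by metis
    also have "\<dots> = (\<Sum>(a,b,c,d,e,f) \<in> {(a,b,c,d,e,f). a + b + c + d + e + f = k}.
        binary_coeffs n l g a b c d e f * (pairing Pos x x ^ a * pairing Pos x y ^ b
        * pairing Pos x 0 ^ c * pairing Pos y y ^ d * pairing Pos y 0 ^ e * pairing Pos 0 0 ^ f))"
      unfolding sf_op_B_symbol_exp by (simp add: \<nu>_def)
    also have "\<dots> = (\<Sum>(a,b,c,d,e,f) \<in> {(a,b,c,d,e,f). c = 0 \<and> e = 0 \<and> f = 0 \<and> a + b + d = k}.
        binary_coeffs n l g a b c d e f * (pairing Pos x x ^ a * pairing Pos x y ^ b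
        * pairing Pos x 0 ^ c * pairing Pos y y ^ d * pairing Pos y 0 ^ e * pairing Pos 0 0 ^ f))"
    proof (rule sum.mono_neutral_right)
      show "finite {(a,b,c,d,e,f). a + b + c + d + e + f = k}"
        by (rule finite_subset[of _ "{..k} \<times> {..k} \<times> {..k} \<times> {..k} \<times> {..k} \<times> {..k}"]) auto
      show "\<forall>v \<in> {(a,b,c,d,e,f). a + b + c + d + e + f = k}
          - {(a,b,c,d,e,f). c = 0 \<and> e = 0 \<and> f = 0 \<and> a + b + d = k}.
          (case v of (a,b,c,d,e,f) \<Rightarrow> binary_coeffs n l g a b c d e f * (pairing Pos x x ^ a * pairing Pos x y ^ b
          * pairing Pos x 0 ^ c * pairing Pos y y ^ d * pairing Pos y 0 ^ e * pairing Pos 0 0 ^ f)) = 0"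
      proof (rule ballI, goal_cases)
        case (1 v)
        obtain a b c d e f where v: "v = (a,b,c,d,e,f)" by (cases v)
        have "\<not> (c = 0 \<and> e = 0 \<and> f = 0)" using 1 unfolding v by auto
        then have "binary_coeffs n l g a b c d e f = 0" unfolding binary_coeffs_def by (rule if_not_P)
        then show ?case unfolding v by simp
      qed
    qed auto
    also have "\<dots> = (\<Sum>(a,b) \<in> Sigma {..k} (\<lambda>a. {..k - a}).
        C a b * (pairing Pos x x ^ a * pairing Pos x y ^ b * pairing Pos y y ^ (k - a - b)))"
      by (rule sum.reindex_bij_witness[where i = "\<lambda>(a,b). (a, b, 0, k - a - b, 0, 0)"
            and j = "\<lambda>(a,b,c,d,e,f). (a,b)"])
        (auto simp: binary_coeffs_def C_def simp del: bin_coeff.simps)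
    also have "\<dots> = (\<Sum>a\<le>k. \<Sum>b\<le>k - a.
        C a b * (pairing Pos x x ^ a * pairing Pos x y ^ b * pairing Pos y y ^ (k - a - b)))"
      by (rule sum.Sigma[symmetric]) auto
    finally show ?thesis
      unfolding xx xy yy by (simp add: sum_distrib_right sum_distrib_left mult_ac)
  qed
  have q0: "(\<Sum>b\<le>k. C 0 b * (eps Pos i * s) ^ b * eps Pos i ^ (k - b)) = 0" for s
  proof (rule ccontr)
    let ?q = "\<lambda>a. (\<Sum>b\<le>k - a. C a b * (eps Pos i * s) ^ b * eps Pos i ^ (k - a - b))"
    assume "(\<Sum>b\<le>k. C 0 b * (eps Pos i * s) ^ b * eps Pos i ^ (k - b)) \<noteq> 0"
    then have "\<exists>a\<le>k. ?q a \<noteq> 0" by (intro exI[of _ 0]) simp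
    then have "finite {X. (\<Sum>a\<le>k. ?q a * X ^ a) = 0}" by (simp only: polyfun_finite_roots)
    \<comment> \<open>A nonzero polynomial in the square of the first covector cannot have all these zeros.\<close>
    then have "finite ((\<lambda>t. eps Pos i * s\<^sup>2 + eps Pos j * t\<^sup>2) ` {0..})"
      by (rule finite_subset[rotated]) (use sum0 in auto)
    moreover have "inj_on (\<lambda>t. eps Pos i * s\<^sup>2 + eps Pos j * t\<^sup>2) {0..}"
      by (auto simp: inj_on_def eps_def split: if_splits)
    ultimately have "finite {0::real..}" by (rule finite_imageD)
    then show False using infinite_Ici by blast
  qed
  have "(\<Sum>b\<le>k. C 0 b * eps Pos i ^ k * s ^ b) = 0" for s
  proof -
    have "eps Pos i ^ k = eps Pos i ^ b * eps Pos i ^ (k - b)" if "b \<le> k" for b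
      using that by (simp flip: power_add)
    then have "(\<Sum>b\<le>k. C 0 b * eps Pos i ^ k * s ^ b)
        = (\<Sum>b\<le>k. C 0 b * (eps Pos i * s) ^ b * eps Pos i ^ (k - b))"
      by (intro sum.cong) (auto simp: power_mult_distrib)
    then show ?thesis using q0[of s] by simp
  qed
  then have "C 0 k * eps Pos i ^ k = 0"
    using Transcendental.polyfun_eq_0[of "\<lambda>b. C 0 b * eps Pos i ^ k" k] by auto
  moreover have "eps Pos i ^ k \<noteq> 0" by (simp add: eps_def)
  ultimately show False by (simp add: C_def)
qed

section \<open>Generic weights\<close>

lemma AE_inner_neq:
  fixes v :: "'a::euclidean_space"
  assumes "v \<noteq> 0"
  shows "AE x in lborel. v \<bullet> x \<noteq> c"
proof (rule AE_I')
  have "{x. v \<bullet> x = c} \<in> sets lborel"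
    using closed_hyperplane[of v c] by simp
  moreover have "negligible {x. v \<bullet> x = c}" using negligible_hyperplane assms by blast
  ultimately show "{x. v \<bullet> x = c} \<in> null_sets lborel"
    by (simp add: negligible_iff_null_sets null_sets_completion_iff)
qed auto

text \<open>The leading coefficients of the two recursions vanish on countably many hyperplanes only.\<close>

lemma AE_generic_weights:
  assumes "n > 0"
  shows "AE (l, g, t) in (lborel :: (real \<times> real \<times> real) measure).
    (\<forall>a::nat. 2 * (real a + 1) + n * (2 * l - 1) \<noteq> 0) \<and> (\<forall>a::nat. 2 * (real a + 1) + n * (2 * g - 1) \<noteq> 0)"
proof -
  define c where "c a = (1 - 2 * (real a + 1) / n) / 2" for a :: nat
  have c: "x = c a" if "2 * (real a + 1) + n * (2 * x - 1) = 0" for x a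
  proof -
    have "n * (2 * c a - 1) = - (2 * (real a + 1))" using assms by (simp add: c_def field_simps)
    then have "n * (2 * x - 1) = n * (2 * c a - 1)" using that by linarith
    then show ?thesis using assms by simp
  qed
  have "AE x in (lborel :: (real \<times> real \<times> real) measure). \<forall>a. (1,0,0) \<bullet> x \<noteq> c a \<and> (0,1,0) \<bullet> x \<noteq> c a"
    by (subst AE_all_countable) (auto intro!: AE_conjI AE_inner_neq simp: zero_prod_def)
  then show ?thesis
  proof eventually_elim
    case (elim x)
    obtain l g t where x: "x = (l, g, t)" by (cases x)
    then have "l \<noteq> c a \<and> g \<noteq> c a" for a using elim by simp
    then show ?case unfolding x prod.case using c by blast
  qed
qed

section \<open>Invariant ternary operators\<close>

lemma invariant_B_op:
  fixes Pos :: "'n::finite set"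
  assumes "induction_formulas CARD('n) l g t k \<alpha>"
  shows "invariant_op (conf_algebra Pos) l g t (l + g + t + 2 * real k / real CARD('n)) (B_op Pos k \<alpha>)"
proof -
  define w where "w = case_slot l g t"
  have ind: "induction_formulas CARD('n) (w Xi) (w Eta) (w Zeta) k \<alpha>"
    using assms by (simp add: w_def)
  have "invariant_op (conf_algebra Pos) (w Xi) (w Eta) (w Zeta)
      (l + g + t + 2 * real k / real CARD('n)) (B_op Pos k \<alpha>)"
  proof (rule invariant_op_symbol)
    fix i j
    have "(\<Sum>s\<in>UNIV. rot_sym Pos i j s (B_symbol Pos k \<alpha>)) = of_int (int k) * 0 * B_symbol Pos k \<alpha>"
      unfolding B_symbol_zmon_sum
      by (rule derivation_zmon_sum_homogeneous[OF rot_total_derivation]) (simp_all add: rot_R2, simp add: rot_sym_def)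
    then show "(\<Sum>s\<in>UNIV. rot_sym Pos i j s (B_symbol Pos k \<alpha>)) = 0" by simp
  next
    have "(\<Sum>s\<in>UNIV. euler_sym s (B_symbol Pos k \<alpha>)) = of_int (int k) * 2 * B_symbol Pos k \<alpha>"
      unfolding B_symbol_zmon_sum
      by (rule derivation_zmon_sum_homogeneous[OF euler_total_derivation]) (simp_all add: euler_R2 euler_const)
    also have "of_int (int k) * 2 = const (real k * 2)"
      by (simp add: const_simps const_of_nat const_numeral)
    finally show "(\<Sum>s\<in>UNIV. euler_sym s (B_symbol Pos k \<alpha>)) = const (real k * 2) * B_symbol Pos k \<alpha>" .
  next
    fix i
    show "(\<Sum>s\<in>UNIV. inv_sym Pos (w s) i s (B_symbol Pos k \<alpha>)) = 0"
      by (rule inv_B_symbol[OF ind])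
  next
    show "(l + g + t + 2 * real k / real CARD('n)) * real CARD('n) = (\<Sum>s\<in>UNIV. w s) * real CARD('n) + real k * 2"
      by (simp add: sum_slot w_def field_simps)
  qed
  then show ?thesis by (simp add: w_def)
qed

theorem theorem3p1:
  fixes Pos :: "'n::finite set" and p q n :: nat
  assumes "card Pos = p" and "card (- Pos) = q"
    and "n = p + q" and "n > 1"
  shows "AE (l, g, t) in (lborel :: (real \<times> real \<times> real) measure). \<forall>k::nat.
    (\<exists>\<alpha>. induction_formulas n l g t k \<alpha> \<and> nonzero_op (B_op Pos k \<alpha>) \<and>
         invariant_op (conf_algebra Pos) l g t (l + g + t + 2 * real k / real n) (B_op Pos k \<alpha>)) \<and>
    (\<forall>\<alpha>. induction_formulas n l g t k \<alpha> \<longrightarrow>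
         invariant_op (conf_algebra Pos) l g t (l + g + t + 2 * real k / real n) (B_op Pos k \<alpha>))"
proof -
  have n: "n = CARD('n)"
    using assms card_Un_disjoint[of Pos "- Pos"] by (simp add: Compl_partition)
  have "AE (l, g, t) in (lborel :: (real \<times> real \<times> real) measure).
    (\<forall>a::nat. 2 * (real a + 1) + real n * (2 * l - 1) \<noteq> 0) \<and> (\<forall>a::nat. 2 * (real a + 1) + real n * (2 * g - 1) \<noteq> 0)"
    using AE_generic_weights[of "real n"] assms(4) by simp
  then show ?thesis
  proof eventually_elim
    case (elim x)
    obtain l g t where x: "x = (l, g, t)" by (cases x)
    have generic: "2 * (real a + 1) + real n * (2 * l - 1) \<noteq> 0" "2 * (real a + 1) + real n * (2 * g - 1) \<noteq> 0"
      for a :: nat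
      using elim unfolding x by auto
    have inv: "invariant_op (conf_algebra Pos) l g t (l + g + t + 2 * real k / real n) (B_op Pos k \<alpha>)"
      if "induction_formulas n l g t k \<alpha>" for k \<alpha>
      using invariant_B_op that unfolding n by blast
    have "induction_formulas n l g t k (binary_coeffs n l g)" for k
      by (rule binary_coeffs_induction) (rule generic)+
    moreover have "nonzero_op (B_op Pos k (binary_coeffs n l g))" for k
      using nonzero_binary assms(4) unfolding n by blast
    ultimately show ?case unfolding x using inv by blast
  qed
qed

end
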